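(* Let $k\ge 2$ be fixed, let $\mathbb F$ be a finite field, and let $\ell\ge k/2$ be an integer. There is a constant $C$ (independent of $n,\ell,|\mathbb F|$) such that the following holds. Let $\mathcal H$ be a set of $k$-sparse vectors in $\mathbb F^n$ with $|\mathcal H|\ge C\,n\cdot\left(\frac{n|\mathbb F^*|}{\ell}\right)^{k/2-1}\cdot\log(|\mathbb F^*|n)$. Then there exist a nonempty set $\mathcal V\subseteq\mathcal H$ with $|\mathcal V|\le \ell\log(|\mathbb F^*|n)$ and coefficients $\{\alpha_v\}_{v\in\mathcal V}$ in $\mathbb F^*$ such that $\sum_{v\in\mathcal V}\alpha_v\cdot v=0$.
   Context: $\mathbb F^*=\mathbb F\setminus\{0\}$. A vector $v\in\mathbb F^n$ is $k$-sparse if exactly $k$ of its coordinates are nonzero.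
   Formalization: The formal theorem also assumes n ≥ 2 and ℓ ≤ n|F*|; without these the claim fails: for n=1, F=F_2 the threshold is 0 and H may be empty, and for k ≥ 3 and ℓ → ∞ the threshold tends to 0, so a single nonzero vector would qualify as H. *)

theory Defs
  imports Complex_Main "HOL-Algebra.Ring" "HOL-Library.FuncSet"
begin

(* Fields are HOL-Algebra records rather than types of class field, so that a statement can
   quantify over the field after (inside) the existential quantifier for a constant.  At the
   instance 'a = nat the fields over 'a already include a copy of every finite field, so a
   constant chosen before "F :: 'a ring" is uniform over all finite fields. *)

definition nonzero_elems :: "('a, 'm) ring_scheme \<Rightarrow> 'a set" where
  "nonzero_elems F = carrier F - {\<zero>\<^bsub>F\<^esub>}"

(* The extensional function space makes equality of vectors equality of their n coordinates,
   so that the cardinality of a set of vectors is the intended one. *)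
definition coord_space :: "('a, 'm) ring_scheme \<Rightarrow> nat \<Rightarrow> (nat \<Rightarrow> 'a) set" where
  "coord_space F n = {..<n} \<rightarrow>\<^sub>E carrier F"

definition zero_vector :: "('a, 'm) ring_scheme \<Rightarrow> nat \<Rightarrow> nat \<Rightarrow> 'a" where
  "zero_vector F n = (\<lambda>i\<in>{..<n}. \<zero>\<^bsub>F\<^esub>)"

definition lin_comb ::
  "('a, 'm) ring_scheme \<Rightarrow> nat \<Rightarrow> ((nat \<Rightarrow> 'a) \<Rightarrow> 'a) \<Rightarrow> (nat \<Rightarrow> 'a) set \<Rightarrow> nat \<Rightarrow> 'a" where
  "lin_comb F n \<alpha> V = (\<lambda>i\<in>{..<n}. \<Oplus>\<^bsub>F\<^esub>v\<in>V. \<alpha> v \<otimes>\<^bsub>F\<^esub> v i)"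

definition sparse_vector :: "('a, 'm) ring_scheme \<Rightarrow> nat \<Rightarrow> nat \<Rightarrow> (nat \<Rightarrow> 'a) \<Rightarrow> bool" where
  "sparse_vector F n k v \<longleftrightarrow> v \<in> coord_space F n \<and> card {i \<in> {..<n}. v i \<noteq> \<zero>\<^bsub>F\<^esub>} = k"

end

theory Submission
  imports Defs
begin

text \<open>Kikuchi graphs. Fix a scalar multiple of each vector and collect vectors that agree on \<open>t\<close> common
  coordinates into groups of size about \<open>(n |F*| / l) ^ (k / 2 - t)\<close>, choosing \<open>t\<close> as large as
  possible, so that more than \<open>t\<close> coordinates are shared by few vectors. For \<open>x, y\<close> in the same group
  and a scalar \<open>c\<close>, the vector \<open>c (y - x)\<close> has at most \<open>2 (k - t)\<close> nonzero entries. The vertices of the graph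
  are arrays of \<open>(k - t) l\<close> pairs (coordinate, scalar), each of which encodes the sum of the
  corresponding multiples of unit vectors; an arc overwrites \<open>k - t\<close> cells that contain half of
  \<open>c x\<close> and half of \<open>- c y\<close> by the other halves, which adds \<open>c (y - x)\<close> to the encoded vector.

  The average degree is a large multiple of \<open>l ln (n |F*|)\<close>, while on average an arc is in conflict
  with a bounded number of other arcs at the same vertex, that is, shares with them a vector or the
  group and, up to sign, the scalar. After deleting arcs with many conflicts and passing to a subgraph
  of large minimum degree, there are more conflict-free walks of length \<open>r = l ln (n |F*|) / 4\<close> than the
  number of vertices times the number of walks with prescribed groups and scalars. So two walks with
  the same endpoints differ in their groups and scalars, and the difference of the two resulting
  linear combinations is a dependency among at most \<open>4 r\<close> vectors. This treats even and odd \<open>k\<close>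
  alike.\<close>

section \<open>Rainbow walks in coloured digraphs\<close>

text \<open>Walks with common endpoints give a dependency only if their linear combinations differ,
  and counting walks alone does not exclude that all of them use the same vectors with the same
  coefficients. Colours resolve this. On a walk without repeated colours every vector lies on one
  arc only, so its coefficient is the scalar of that arc up to sign, and the coefficients determine
  which pairs of a group and a scalar up to sign occur. Walks with different sets of such pairs thus
  have different combinations. Walks with a prescribed set number at most \<open>(r * B) ^ r\<close>
  from one start, and the degree exceeds \<open>r * B\<close> by a constant factor; over
  \<open>r\<close> steps this must beat the \<open>(n * card nz) ^ (s * l)\<close> states, hence
  \<open>r\<close> proportional to \<open>l ln (n |F*|)\<close>: the logarithm of the theorem.

  Differences inside a group make the shared coordinates cancel. A group shares at least one
  coordinate, so the larger half of the other \<open>k - t\<close> entries, rounding included, has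
  at most \<open>k / 2\<close> of them; the size estimates ask for no more, whatever the parity of
  \<open>k\<close>.\<close>

locale coloured_digraph =
  fixes src tgt :: "'e \<Rightarrow> 'v" and col :: "'e \<Rightarrow> 'c set"
begin

primrec rainbow :: "'v \<Rightarrow> 'c set \<Rightarrow> 'e list \<Rightarrow> bool" where
  "rainbow x C [] \<longleftrightarrow> True"
| "rainbow x C (e # p) \<longleftrightarrow> src e = x \<and> col e \<inter> C = {} \<and> rainbow (tgt e) (C \<union> col e) p"

primrec endpoint :: "'v \<Rightarrow> 'e list \<Rightarrow> 'v" where
  "endpoint x [] = x"
| "endpoint x (e # p) = endpoint (tgt e) p"

definition arcs_within :: "'e set \<Rightarrow> 'v set \<Rightarrow> 'e set" where
  "arcs_within E W = {e \<in> E. src e \<in> W \<and> tgt e \<in> W}"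

lemma finite_lists_within:
  assumes "finite E"
  shows "finite {p. set p \<subseteq> E \<and> length p = r \<and> P p}"
  by (rule finite_subset[OF _ finite_lists_length_eq[OF assms, of r]]) auto

text \<open>A smallest vertex set with more than \<open>2 * \<delta>\<close> arcs per vertex works:
  deleting a vertex of out-degree below \<open>\<delta>\<close> would remove fewer than
  \<open>2 * \<delta>\<close> arcs, since \<open>opp\<close> maps the arcs into it to arcs out of
  it, and would leave a smaller such set.\<close>

lemma min_degree_subgraph:
  assumes "finite V" "finite E" and rev: "\<And>e. e \<in> E \<Longrightarrow> opp e \<in> E"
    "\<And>e. e \<in> E \<Longrightarrow> opp (opp e) = e" "\<And>e. e \<in> E \<Longrightarrow> src (opp e) = tgt e"
    and V: "\<And>e. e \<in> E \<Longrightarrow> src e \<in> V"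
    and large: "2 * \<delta> * card V < card E"
  obtains W where "W \<subseteq> V" "W \<noteq> {}" "\<And>x. x \<in> W \<Longrightarrow> \<delta> \<le> card {e \<in> arcs_within E W. src e = x}"
proof -
  define P where "P = (\<lambda>W. W \<subseteq> V \<and> 2 * \<delta> * card W < card (arcs_within E W))"
  have tgtV: "tgt e \<in> V" if "e \<in> E" for e
    using that V rev by metis
  have "arcs_within E V = E"
    using V tgtV unfolding arcs_within_def by blast
  then have PV: "P V"
    using large by (simp add: P_def)
  then obtain W where PW: "P W" and minW: "\<And>U. P U \<Longrightarrow> card W \<le> card U"
    by (metis arg_min_nat_lemma)
  have WV: "W \<subseteq> V" and lW: "2 * \<delta> * card W < card (arcs_within E W)"
    using PW unfolding P_def by auto
  have finW: "finite W"
    using WV \<open>finite V\<close> finite_subset by blast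
  have ne: "W \<noteq> {}"
    using lW by (auto simp: arcs_within_def)
  have "\<delta> \<le> card {e \<in> arcs_within E W. src e = x}" if "x \<in> W" for x
  proof (rule ccontr)
    assume small: "\<not> ?thesis"
    let ?O = "{e \<in> arcs_within E W. src e = x}" and ?I = "{e \<in> arcs_within E W. tgt e = x}"
    have fin: "finite (arcs_within E W)"
      using \<open>finite E\<close> by (simp add: arcs_within_def)
    have "?I \<subseteq> opp ` ?O"
    proof
      fix e assume "e \<in> ?I"
      then have e: "e \<in> E" "src e \<in> W" "tgt e \<in> W" "tgt e = x"
        by (auto simp: arcs_within_def)
      have "src e = tgt (opp e)"
        using rev e(1) by metis
      then have "opp e \<in> ?O"
        using e rev by (auto simp: arcs_within_def)
      then show "e \<in> opp ` ?O"
        using rev(2)[OF e(1)] by (metis imageI)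
    qed
    moreover have finO: "finite ?O"
      using fin by simp
    ultimately have "card ?I \<le> card ?O"
      using surj_card_le by blast
    moreover have "arcs_within E W \<subseteq> arcs_within E (W - {x}) \<union> (?O \<union> ?I)"
      by (auto simp: arcs_within_def)
    then have "card (arcs_within E W) \<le> card (arcs_within E (W - {x}) \<union> (?O \<union> ?I))"
      using \<open>finite E\<close> by (intro card_mono) (auto simp: arcs_within_def)
    then have "card (arcs_within E W) \<le> card (arcs_within E (W - {x})) + (card ?O + card ?I)"
      by (meson card_Un_le add_left_mono order_trans)
    ultimately have "card (arcs_within E W) < card (arcs_within E (W - {x})) + 2 * \<delta>"
      using small by linarith
    moreover have "card W = Suc (card (W - {x}))"
      using that finW by (metis card_Suc_Diff1)
    ultimately have "2 * \<delta> * card (W - {x}) < card (arcs_within E (W - {x}))"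
      using lW by (simp add: algebra_simps)
    then have "P (W - {x})"
      using WV by (auto simp: P_def)
    then show False
      using minW[of "W - {x}"] \<open>card W = Suc (card (W - {x}))\<close> by simp
  qed
  then show ?thesis
    using that WV ne by blast
qed

text \<open>Each colour met so far blocks at most \<open>B\<close> arcs at the current vertex.
  \<open>R\<close> bounds the total length: with three colours per arc at most \<open>3 * R\<close>
  colours are ever met, which leaves \<open>d\<close> choices at each of the \<open>r\<close>
  remaining steps.\<close>

lemma card_rainbow_ge:
  assumes "finite E" and col: "\<And>e. e \<in> E \<Longrightarrow> finite (col e) \<and> card (col e) \<le> 3"
    and B: "\<And>x a. card {e \<in> E. src e = x \<and> a \<in> col e} \<le> B"
    and deg: "\<And>x. x \<in> W \<Longrightarrow> d + 3 * R * B \<le> card {e \<in> E. src e = x}"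
    and tgt: "\<And>e. e \<in> E \<Longrightarrow> tgt e \<in> W"
  shows "x \<in> W \<Longrightarrow> finite C \<Longrightarrow> card C + 3 * r \<le> 3 * R \<Longrightarrow>
    d ^ r \<le> card {p. set p \<subseteq> E \<and> length p = r \<and> rainbow x C p}"
proof (induction r arbitrary: x C)
  case 0
  have "{p. set p \<subseteq> E \<and> length p = 0 \<and> rainbow x C p} = {[]}"
    by auto
  then show ?case by simp
next
  case (Suc r)
  define N where "N = {e \<in> E. src e = x \<and> col e \<inter> C = {}}"
  let ?Q = "\<lambda>e. {p. set p \<subseteq> E \<and> length p = r \<and> rainbow (tgt e) (C \<union> col e) p}"
  have finN: "finite N"
    using \<open>finite E\<close> by (simp add: N_def)
  have "{e \<in> E. src e = x} \<subseteq> N \<union> (\<Union>a\<in>C. {e \<in> E. src e = x \<and> a \<in> col e})"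
    by (auto simp: N_def)
  then have "card {e \<in> E. src e = x} \<le> card (N \<union> (\<Union>a\<in>C. {e \<in> E. src e = x \<and> a \<in> col e}))"
    using \<open>finite E\<close> finN \<open>finite C\<close> by (intro card_mono) auto
  also have "\<dots> \<le> card N + card (\<Union>a\<in>C. {e \<in> E. src e = x \<and> a \<in> col e})"
    by (rule card_Un_le)
  also have "card (\<Union>a\<in>C. {e \<in> E. src e = x \<and> a \<in> col e})
      \<le> (\<Sum>a\<in>C. card {e \<in> E. src e = x \<and> a \<in> col e})"
    by (rule card_UN_le) (use \<open>finite C\<close> in auto)
  also have "\<dots> \<le> (\<Sum>a\<in>C. B)"
    by (intro sum_mono B)
  also have "\<dots> \<le> 3 * R * B"
    using Suc.prems(3) by (auto intro: mult_right_mono)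
  finally have dN: "d \<le> card N"
    using deg[OF Suc.prems(1)] by linarith
  have IH: "d ^ r \<le> card (?Q e)" if "e \<in> N" for e
  proof (rule Suc.IH)
    have e: "e \<in> E" using that by (simp add: N_def)
    then show "tgt e \<in> W" by (rule tgt)
    show "finite (C \<union> col e)" using col[OF e] Suc.prems(2) by simp
    have "card (C \<union> col e) \<le> card C + card (col e)" by (rule card_Un_le)
    then show "card (C \<union> col e) + 3 * r \<le> 3 * R"
      using conjunct2[OF col[OF e]] Suc.prems(3) by simp
  qed
  have eq: "{p. set p \<subseteq> E \<and> length p = Suc r \<and> rainbow x C p}
      = (\<lambda>(e, p). e # p) ` (SIGMA e:N. ?Q e)"
    by (force simp: N_def length_Suc_conv)
  have "d ^ Suc r \<le> (\<Sum>e\<in>N. d ^ r)"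
    using dN by simp
  also have "\<dots> \<le> (\<Sum>e\<in>N. card (?Q e))"
    by (intro sum_mono IH)
  also have "\<dots> = card (SIGMA e:N. ?Q e)"
    using finN finite_lists_within[OF \<open>finite E\<close>] by (subst card_SigmaI) auto
  also have "\<dots> = card {p. set p \<subseteq> E \<and> length p = Suc r \<and> rainbow x C p}"
    unfolding eq by (subst card_image) (auto simp: inj_on_def)
  finally show ?case .
qed

text \<open>The key of an arc is one of its colours, so at most \<open>B\<close> arcs leave a vertex
  with a given key, and each step has at most \<open>card K * B\<close> choices.\<close>

lemma card_walks_keys_le:
  assumes "finite E" "finite K"
    and B: "\<And>x a. card {e \<in> E. src e = x \<and> a \<in> col e} \<le> B"
    and key: "\<And>e. e \<in> E \<Longrightarrow> key e \<in> col e"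
  shows "card {p. set p \<subseteq> E \<and> length p = r \<and> rainbow x C p \<and> key ` set p \<subseteq> K}
    \<le> (card K * B) ^ r"
proof (induction r arbitrary: x C)
  case 0
  have "{p. set p \<subseteq> E \<and> length p = 0 \<and> rainbow x C p \<and> key ` set p \<subseteq> K} = {[]}"
    by auto
  then show ?case by simp
next
  case (Suc r)
  define N where "N = {e \<in> E. src e = x \<and> key e \<in> K}"
  let ?Q = "\<lambda>e. {p. set p \<subseteq> E \<and> length p = r \<and> rainbow (tgt e) (C \<union> col e) p \<and> key ` set p \<subseteq> K}"
  have finN: "finite N"
    using \<open>finite E\<close> by (simp add: N_def)
  have finQ: "finite (?Q e)" for e
    by (rule finite_lists_within[OF \<open>finite E\<close>])
  have "N \<subseteq> (\<Union>a\<in>K. {e \<in> E. src e = x \<and> a \<in> col e})"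
    using key by (auto simp: N_def)
  then have "card N \<le> card (\<Union>a\<in>K. {e \<in> E. src e = x \<and> a \<in> col e})"
    using \<open>finite E\<close> \<open>finite K\<close> by (intro card_mono) auto
  also have "\<dots> \<le> (\<Sum>a\<in>K. card {e \<in> E. src e = x \<and> a \<in> col e})"
    by (rule card_UN_le) (use \<open>finite K\<close> in auto)
  also have "\<dots> \<le> (\<Sum>a\<in>K. B)"
    by (intro sum_mono B)
  finally have N: "card N \<le> card K * B" by simp
  have "{p. set p \<subseteq> E \<and> length p = Suc r \<and> rainbow x C p \<and> key ` set p \<subseteq> K}
      \<subseteq> (\<lambda>(e, p). e # p) ` (SIGMA e:N. ?Q e)"
    by (force simp: N_def length_Suc_conv)
  then have "card {p. set p \<subseteq> E \<and> length p = Suc r \<and> rainbow x C p \<and> key ` set p \<subseteq> K}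
      \<le> card (SIGMA e:N. ?Q e)"
    using finN finQ by (meson finite_SigmaI surj_card_le)
  also have "\<dots> = (\<Sum>e\<in>N. card (?Q e))"
    using finN finQ by (subst card_SigmaI) auto
  also have "\<dots> \<le> (\<Sum>e\<in>N. (card K * B) ^ r)"
    by (intro sum_mono Suc.IH)
  also have "\<dots> \<le> (card K * B) ^ Suc r"
    using N by (simp add: mult_right_mono)
  finally show ?case .
qed

text \<open>If all rainbow walks with common endpoints had the same keys, each endpoint would be reached
  by at most \<open>(r * B) ^ r\<close> of them, too few for a graph of large minimum degree.\<close>

lemma two_walks_of_bounded_multiplicity:
  assumes "finite V" "finite E" and rev: "\<And>e. e \<in> E \<Longrightarrow> opp e \<in> E"
    "\<And>e. e \<in> E \<Longrightarrow> opp (opp e) = e" "\<And>e. e \<in> E \<Longrightarrow> src (opp e) = tgt e"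
    and V: "\<And>e. e \<in> E \<Longrightarrow> src e \<in> V"
    and col: "\<And>e. e \<in> E \<Longrightarrow> finite (col e) \<and> card (col e) \<le> 3"
    and B: "\<And>x a. card {e \<in> E. src e = x \<and> a \<in> col e} \<le> B"
    and key: "\<And>e. e \<in> E \<Longrightarrow> key e \<in> col e"
    and large: "2 * (d + 3 * r * B) * card V < card E"
    and d: "card V * (r * B) ^ r < d ^ r"
  obtains x p p' where "set p \<subseteq> E" "set p' \<subseteq> E" "length p = r" "length p' = r"
    "rainbow x {} p" "rainbow x {} p'" "endpoint x p = endpoint x p'" "key ` set p \<noteq> key ` set p'"
proof -
  obtain W where W: "W \<subseteq> V" "W \<noteq> {}"
    and deg: "\<And>x. x \<in> W \<Longrightarrow> d + 3 * r * B \<le> card {e \<in> arcs_within E W. src e = x}"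
    using min_degree_subgraph[where \<delta> = "d + 3 * r * B", OF assms(1,2) rev V large] by blast
  define E' where "E' = arcs_within E W"
  have E': "E' \<subseteq> E" "finite E'" "\<And>e. e \<in> E' \<Longrightarrow> tgt e \<in> W"
    using \<open>finite E\<close> by (auto simp: E'_def arcs_within_def)
  have B': "card {e \<in> E'. src e = x \<and> a \<in> col e} \<le> B" for x a
    by (rule order_trans[OF card_mono B[of x a]]) (use E' \<open>finite E\<close> in auto)
  obtain x where x: "x \<in> W" using W(2) by blast
  define Q where "Q = {p. set p \<subseteq> E' \<and> length p = r \<and> rainbow x {} p}"
  have finQ: "finite Q"
    unfolding Q_def by (rule finite_lists_within[OF E'(2)])
  have lower: "d ^ r \<le> card Q"
    unfolding Q_def
  proof (rule card_rainbow_ge[OF E'(2) _ B' _ E'(3) x])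
    show "finite (col e) \<and> card (col e) \<le> 3" if "e \<in> E'" for e
      using that E'(1) col by blast
    show "d + 3 * r * B \<le> card {e \<in> E'. src e = x}" if "x \<in> W" for x
      using deg[OF that] by (simp add: E'_def)
  qed auto
  have finV: "finite W" using W(1) \<open>finite V\<close> finite_subset by blast
  have endW: "endpoint y p \<in> W" if "y \<in> W" "set p \<subseteq> E'" for y p
    using that by (induction p arbitrary: y) (simp_all add: E'(3))
  have "\<exists>p\<in>Q. \<exists>p'\<in>Q. endpoint x p = endpoint x p' \<and> key ` set p \<noteq> key ` set p'"
  proof (rule ccontr)
    assume "\<not> ?thesis"
    then have same: "key ` set p = key ` set p'"
      if "p \<in> Q" "p' \<in> Q" "endpoint x p = endpoint x p'" for p p'
      using that by blast
    have fib: "card {p \<in> Q. endpoint x p = y} \<le> (r * B) ^ r" for y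
    proof (cases "{p \<in> Q. endpoint x p = y} = {}")
      case False
      then obtain p0 where p0: "p0 \<in> Q" "endpoint x p0 = y" by blast
      have "{p \<in> Q. endpoint x p = y}
          \<subseteq> {p. set p \<subseteq> E' \<and> length p = r \<and> rainbow x {} p \<and> key ` set p \<subseteq> key ` set p0}"
      proof
        fix p assume "p \<in> {p \<in> Q. endpoint x p = y}"
        then have p: "p \<in> Q" "endpoint x p = endpoint x p0" using p0(2) by simp_all
        have "key ` set p = key ` set p0" by (rule same[OF p(1) p0(1) p(2)])
        with p(1) show "p \<in> {p. set p \<subseteq> E' \<and> length p = r \<and> rainbow x {} p \<and> key ` set p \<subseteq> key ` set p0}"
          unfolding Q_def by blast
      qed
      then have "card {p \<in> Q. endpoint x p = y}
          \<le> card {p. set p \<subseteq> E' \<and> length p = r \<and> rainbow x {} p \<and> key ` set p \<subseteq> key ` set p0}"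
        using finite_lists_within[OF E'(2)] by (intro card_mono) auto
      also have "\<dots> \<le> (card (key ` set p0) * B) ^ r"
        by (rule card_walks_keys_le) (use E' B' key in auto)
      also have "\<dots> \<le> (r * B) ^ r"
      proof -
        have "card (key ` set p0) \<le> r"
          using p0(1) by (auto simp: Q_def intro: order_trans[OF card_image_le card_length])
        then show ?thesis by (intro power_mono mult_right_mono) auto
      qed
      finally show ?thesis .
    next
      case True
      then show ?thesis by (metis card.empty zero_le)
    qed
    have "Q = (\<Union>y\<in>W. {p \<in> Q. endpoint x p = y})"
      using endW x by (auto simp: Q_def)
    then have "card Q \<le> (\<Sum>y\<in>W. card {p \<in> Q. endpoint x p = y})"
      using card_UN_le[OF finV, of "\<lambda>y. {p \<in> Q. endpoint x p = y}"] by simp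
    also have "\<dots> \<le> card W * (r * B) ^ r"
      using sum_bounded_above[of W "\<lambda>y. card {p \<in> Q. endpoint x p = y}"] fib by simp
    also have "\<dots> \<le> card V * (r * B) ^ r"
      using card_mono[OF \<open>finite V\<close> W(1)] by simp
    finally show False
      using lower d by linarith
  qed
  then show ?thesis
    using that E'(1) unfolding Q_def by blast
qed

definition conflicts :: "'e set \<Rightarrow> 'e \<Rightarrow> 'e set" where
  "conflicts E e = {e' \<in> E. src e' = src e \<and> col e' \<inter> col e \<noteq> {}}"

text \<open>Arcs in conflict with more than four times the average number of arcs can be deleted
  together with their reversals.\<close>

theorem two_walks_of_few_conflicts:
  assumes "finite V" "finite E" and rev: "\<And>e. e \<in> E \<Longrightarrow> opp e \<in> E"
    "\<And>e. e \<in> E \<Longrightarrow> opp (opp e) = e" "\<And>e. e \<in> E \<Longrightarrow> src (opp e) = tgt e"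
    and V: "\<And>e. e \<in> E \<Longrightarrow> src e \<in> V"
    and col: "\<And>e. e \<in> E \<Longrightarrow> finite (col e) \<and> card (col e) \<le> 3"
    and key: "\<And>e. e \<in> E \<Longrightarrow> key e \<in> col e"
    and K: "(\<Sum>e\<in>E. card (conflicts E e)) \<le> K * card E"
    and large: "4 * (d + 3 * r * (4 * K)) * card V < card E"
    and d: "card V * (r * (4 * K)) ^ r < d ^ r"
  obtains x p p' where "set p \<subseteq> E" "set p' \<subseteq> E" "length p = r" "length p' = r"
    "rainbow x {} p" "rainbow x {} p'" "endpoint x p = endpoint x p'" "key ` set p \<noteq> key ` set p'"
proof -
  define D where "D = {e \<in> E. 4 * K < card (conflicts E e)}"
  define E' where "E' = {e \<in> E. e \<notin> D \<and> opp e \<notin> D}"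
  have finD: "finite D" using \<open>finite E\<close> by (simp add: D_def)
  have E': "E' \<subseteq> E" "finite E'"
    using \<open>finite E\<close> by (auto simp: E'_def)
  have "4 * card D \<le> card E"
  proof (cases "K = 0")
    case False
    have "(4 * K) * card D \<le> (\<Sum>e\<in>D. card (conflicts E e))"
      using sum_mono[of D "\<lambda>_. 4 * K" "\<lambda>e. card (conflicts E e)"] by (simp add: D_def mult.commute)
    also have "\<dots> \<le> (\<Sum>e\<in>E. card (conflicts E e))"
      using \<open>finite E\<close> by (intro sum_mono2) (auto simp: D_def)
    also have "\<dots> \<le> K * card E" by (rule K)
    finally show ?thesis using False by simp
  next
    case True
    then have "\<forall>e\<in>E. card (conflicts E e) = 0" using K \<open>finite E\<close> by auto
    then have "D = {}" by (auto simp: D_def)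
    then show ?thesis by simp
  qed
  moreover have "E \<subseteq> E' \<union> (D \<union> opp ` D)"
  proof
    fix e assume "e \<in> E"
    then show "e \<in> E' \<union> (D \<union> opp ` D)"
      using rev(2)[of e] by (auto simp: E'_def intro!: image_eqI[of e opp "opp e"])
  qed
  then have "card E \<le> card (E' \<union> (D \<union> opp ` D))"
    using E'(2) finD by (intro card_mono) auto
  then have "card E \<le> card E' + (card D + card (opp ` D))"
    by (meson card_Un_le add_left_mono order_trans)
  moreover have "card (opp ` D) \<le> card D"
    by (rule card_image_le[OF finD])
  ultimately have half: "card E \<le> 2 * card E'" by linarith
  \<comment> \<open>A surviving arc \<open>e0\<close> at \<open>x\<close> of colour \<open>a\<close>
    is in conflict with every arc at \<open>x\<close> of that colour, so the bound on its conflicts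
    bounds the multiplicity of the colour.\<close>
  have mult: "card {e \<in> E'. src e = x \<and> a \<in> col e} \<le> 4 * K" for x a
  proof (cases "{e \<in> E'. src e = x \<and> a \<in> col e} = {}")
    case False
    then obtain e0 where e0: "e0 \<in> E'" "src e0 = x" "a \<in> col e0" by blast
    have "{e \<in> E'. src e = x \<and> a \<in> col e} \<subseteq> conflicts E e0"
      using e0 E'(1) by (auto simp: conflicts_def)
    then have "card {e \<in> E'. src e = x \<and> a \<in> col e} \<le> card (conflicts E e0)"
      using \<open>finite E\<close> by (intro card_mono) (auto simp: conflicts_def)
    also have "\<dots> \<le> 4 * K"
      using e0(1) by (auto simp: E'_def D_def)
    finally show ?thesis .
  next
    case True
    then show ?thesis by (metis card.empty zero_le)
  qed
  have rev': "opp e \<in> E'" if "e \<in> E'" for e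
    using that rev by (simp add: E'_def)
  have "2 * (d + 3 * r * (4 * K)) * card V < card E'"
    using large half by linarith
  then show ?thesis
    using two_walks_of_bounded_multiplicity[where E = E' and V = V and opp = opp and B = "4 * K"
        and key = key and d = d and r = r, OF \<open>finite V\<close> E'(2) rev' _ _ _ _ mult] rev V col key d E'(1) that
    by (smt (verit, best) subset_iff)
qed

end

section \<open>Graphs on tuples\<close>

lemma card_PiE_extending:
  assumes "finite P" "Q \<subseteq> P" "\<And>p. p \<in> Q \<Longrightarrow> f p \<in> X"
  shows "card {S \<in> P \<rightarrow>\<^sub>E X. \<forall>p\<in>Q. S p = f p} = card X ^ (card P - card Q)"
proof -
  have "{S \<in> P \<rightarrow>\<^sub>E X. \<forall>p\<in>Q. S p = f p} = Pi\<^sub>E P (\<lambda>p. if p \<in> Q then {f p} else X)"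
    using assms(2,3) by (auto simp: PiE_iff extensional_def split: if_splits)
  then have "card {S \<in> P \<rightarrow>\<^sub>E X. \<forall>p\<in>Q. S p = f p} = (\<Prod>p\<in>P. if p \<in> Q then 1 else card X)"
    using assms(1) by (simp add: card_PiE if_distrib cong: if_cong)
  also have "\<dots> = (\<Prod>p\<in>P - Q. card X)"
    using assms(1) by (subst prod.If_cases) (auto simp: Int_absorb1 Diff_eq)
  also have "\<dots> = card X ^ (card P - card Q)"
    using assms(1,2) by (simp add: card_Diff_subset finite_subset)
  finally show ?thesis .
qed

text \<open>A Kikuchi graph on arrays instead of sets: the cells form \<open>s\<close> rows of
  length \<open>l\<close>, and an arc reads and overwrites one cell per row. Columns are chosen
  independently, so the states matching one or two patterns are counted by powers of
  \<open>card X\<close>. The patterns \<open>z\<close> and the colours stay abstract, since only the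
  numbers of steps with prescribed pattern entries matter.\<close>

locale tuple_graph =
  fixes X :: "'x set" and l s :: nat and A :: "'a set" and opp :: "'a \<Rightarrow> 'a"
    and z :: "'a \<Rightarrow> nat \<Rightarrow> 'x" and acol :: "'a \<Rightarrow> 'c set"
  assumes finX: "finite X" and finA: "finite A"
    and z: "a \<in> A \<Longrightarrow> i < s \<Longrightarrow> z a i \<in> X"
    and opp: "a \<in> A \<Longrightarrow> opp a \<in> A" "a \<in> A \<Longrightarrow> opp (opp a) = a"
begin

definition pos :: "(nat \<times> nat) set" where
  "pos = {..<s} \<times> {..<l}"

definition states :: "(nat \<times> nat \<Rightarrow> 'x) set" where
  "states = pos \<rightarrow>\<^sub>E X"

definition choices :: "(nat \<Rightarrow> nat) set" where
  "choices = {..<s} \<rightarrow>\<^sub>E {..<l}"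

definition matches :: "(nat \<times> nat \<Rightarrow> 'x) \<Rightarrow> 'a \<times> (nat \<Rightarrow> nat) \<Rightarrow> bool" where
  "matches S u \<longleftrightarrow> (\<forall>i<s. S (i, snd u i) = z (fst u) i)"

definition move :: "(nat \<times> nat \<Rightarrow> 'x) \<Rightarrow> 'a \<times> (nat \<Rightarrow> nat) \<Rightarrow> nat \<times> nat \<Rightarrow> 'x" where
  "move S u = (\<lambda>p\<in>pos. if snd p = snd u (fst p) then z (opp (fst u)) (fst p) else S p)"

definition arcs :: "((nat \<times> nat \<Rightarrow> 'x) \<times> 'a \<times> (nat \<Rightarrow> nat)) set" where
  "arcs = {(S, u). S \<in> states \<and> u \<in> A \<times> choices \<and> matches S u}"

definition reversal where
  "reversal = (\<lambda>(S, u). (move S u, opp (fst u), snd u))"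

sublocale coloured_digraph fst "\<lambda>(S, u). move S u" "\<lambda>(S, u). acol (fst u)" .

lemma finite_pos: "finite pos" and card_pos: "card pos = s * l"
  by (simp_all add: pos_def)

lemma finite_states: "finite states" and card_states: "card states = card X ^ (s * l)"
  using finX finite_pos by (simp_all add: states_def finite_PiE card_PiE card_pos)

lemma finite_choices: "finite choices" and card_choices: "card choices = l ^ s"
  by (simp_all add: choices_def finite_PiE card_PiE)

lemma choices_less: "J \<in> choices \<Longrightarrow> i < s \<Longrightarrow> J i < l"
  by (auto simp: choices_def)

lemma finite_arcs: "finite arcs"
  by (rule finite_subset[of _ "states \<times> A \<times> choices"])
    (auto simp: arcs_def finite_states finA finite_choices)

lemma states_in: "S \<in> states \<Longrightarrow> p \<in> pos \<Longrightarrow> S p \<in> X"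
  by (auto simp: states_def)

lemma move_in_states:
  assumes "S \<in> states" "u \<in> A \<times> choices"
  shows "move S u \<in> states"
proof -
  have "(if snd p = snd u (fst p) then z (opp (fst u)) (fst p) else S p) \<in> X" if "p \<in> pos" for p
  proof (cases "snd p = snd u (fst p)")
    case True
    have "fst u \<in> A" "fst p < s" using assms(2) that by (auto simp: pos_def)
    then have "z (opp (fst u)) (fst p) \<in> X" by (intro z opp(1))
    then show ?thesis using True by simp
  next
    case False
    then show ?thesis using states_in[OF assms(1) that] by simp
  qed
  then show ?thesis
    by (simp add: move_def states_def restrict_PiE_iff)
qed

lemma matches_move:
  assumes "J \<in> choices"
  shows "matches (move S (a, J)) (opp a, J)"
  using choices_less[OF assms] by (auto simp: matches_def move_def pos_def)

lemma move_move:
  assumes "S \<in> states" "a \<in> A" "matches S (a, J)"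
  shows "move (move S (a, J)) (opp a, J) = S"
proof
  fix p
  show "move (move S (a, J)) (opp a, J) p = S p"
  proof (cases "p \<in> pos")
    case True
    then show ?thesis
      using assms by (auto simp: move_def matches_def pos_def opp)
  next
    case False
    then show ?thesis
      using PiE_arb[of S pos "\<lambda>_. X" p] assms(1) by (simp add: move_def states_def)
  qed
qed

lemma reversal:
  assumes "e \<in> arcs"
  shows "reversal e \<in> arcs" "reversal (reversal e) = e" "fst (reversal e) = (case e of (S, u) \<Rightarrow> move S u)"
  using assms by (auto simp: arcs_def reversal_def move_in_states matches_move move_move opp)

section \<open>Counting arcs and pairs of arcs in conflict\<close>

abbreviation spots :: "(nat \<Rightarrow> nat) \<Rightarrow> (nat \<times> nat) set" where
  "spots J \<equiv> (\<lambda>i. (i, J i)) ` {..<s}"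

lemma spots_subset: "J \<in> choices \<Longrightarrow> spots J \<subseteq> pos"
  using choices_less by (auto simp: pos_def)

lemma card_spots: "card (spots J) = s"
  by (subst card_image) (auto simp: inj_on_def)

lemma card_matching:
  assumes "a \<in> A" "J \<in> choices"
  shows "card {S \<in> states. matches S (a, J)} = card X ^ (s * l - s)"
proof -
  have "{S \<in> states. matches S (a, J)} = {S \<in> pos \<rightarrow>\<^sub>E X. \<forall>p\<in>spots J. S p = z a (fst p)}"
    by (auto simp: states_def matches_def)
  then show ?thesis
    using card_PiE_extending[OF finite_pos spots_subset[OF assms(2)], of "\<lambda>p. z a (fst p)" X] z[OF assms(1)]
    by (force simp: card_spots card_pos)
qed

text \<open>Patterns placed in columns \<open>J\<close> and \<open>J'\<close> overlap exactly in the
  rows \<open>I\<close>, so together they prescribe \<open>2 * s - card I\<close> cells. A state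
  \<open>T\<close> matching both supplies the values of these cells and shows that the patterns
  agree on \<open>I\<close>.\<close>

lemma card_matching_both:
  assumes "J \<in> choices" "J' \<in> choices" and a: "a \<in> A" "a' \<in> A"
  defines "I \<equiv> {i. i < s \<and> J' i = J i}"
  assumes ne: "{S \<in> states. matches S (a, J) \<and> matches S (a', J')} \<noteq> {}"
  shows "card {S \<in> states. matches S (a, J) \<and> matches S (a', J')} = card X ^ (s * l - (2 * s - card I))"
    and "2 * s - card I \<le> s * l" and "\<forall>i\<in>I. z a' i = z a i"
proof -
  obtain T where T: "T \<in> states" "matches T (a, J)" "matches T (a', J')"
    using ne by blast
  show "\<forall>i\<in>I. z a' i = z a i"
    using T(2,3) by (auto simp: I_def matches_def)
  have "spots J \<inter> spots J' = (\<lambda>i. (i, J i)) ` I"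
    by (auto simp: I_def)
  then have "card (spots J \<inter> spots J') = card I"
    by (simp add: card_image inj_on_def)
  moreover have "card (spots J) + card (spots J') = card (spots J \<union> spots J') + card (spots J \<inter> spots J')"
    by (rule card_Un_Int) auto
  ultimately have c: "card (spots J \<union> spots J') = 2 * s - card I"
    by (simp only: card_spots)
  have sub: "spots J \<union> spots J' \<subseteq> pos"
    using spots_subset assms(1,2) by blast
  then show "2 * s - card I \<le> s * l"
    using card_mono[OF finite_pos sub] c card_pos by simp
  have "{S \<in> states. matches S (a, J) \<and> matches S (a', J')}
      = {S \<in> pos \<rightarrow>\<^sub>E X. \<forall>p\<in>spots J \<union> spots J'. S p = T p}"
    using T(2,3) by (auto simp: states_def matches_def)
  then show "card {S \<in> states. matches S (a, J) \<and> matches S (a', J')} = card X ^ (s * l - (2 * s - card I))"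
    using card_PiE_extending[OF finite_pos sub, of T X, OF states_in[OF T(1) subsetD[OF sub]]]
    by (simp only: c card_pos)
qed

lemma card_arcs: "card arcs = card A * l ^ s * card X ^ (s * l - s)"
proof -
  have "arcs = prod.swap ` (SIGMA u:A \<times> choices. {S \<in> states. matches S u})"
    by (force simp: arcs_def)
  then have "card arcs = card (SIGMA u:A \<times> choices. {S \<in> states. matches S u})"
    by (simp add: card_image)
  also have "\<dots> = (\<Sum>u\<in>A \<times> choices. card {S \<in> states. matches S u})"
    using finA finite_choices finite_states by (subst card_SigmaI) auto
  also have "\<dots> = (\<Sum>u\<in>A \<times> choices. card X ^ (s * l - s))"
    by (intro sum.cong) (auto simp: card_matching)
  finally show ?thesis
    by (simp add: card_cartesian_product card_choices)
qed

text \<open>Exchanging the sum over states with that over second arcs turns the total number of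
  conflicts into counts of states matching two given patterns at once.\<close>

lemma sum_card_conflicts:
  "(\<Sum>e\<in>arcs. card (conflicts arcs e)) = (\<Sum>u\<in>A \<times> choices.
     \<Sum>u' | u' \<in> A \<times> choices \<and> acol (fst u') \<inter> acol (fst u) \<noteq> {}.
       card {S \<in> states. matches S u \<and> matches S u'})"
proof -
  let ?P = "A \<times> choices"
  let ?c = "\<lambda>u u'. acol (fst u') \<inter> acol (fst u) \<noteq> {}"
  have finP: "finite ?P" using finA finite_choices by simp
  have conf: "card (conflicts arcs (S, u)) = card {u' \<in> ?P. ?c u u' \<and> matches S u'}"
    if "(S, u) \<in> arcs" for S u
  proof -
    have "conflicts arcs (S, u) = Pair S ` {u' \<in> ?P. ?c u u' \<and> matches S u'}"
      using that by (auto simp: conflicts_def arcs_def)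
    then show ?thesis by (simp add: card_image inj_on_def)
  qed
  have in_arcs: "(S, u) \<in> arcs \<longleftrightarrow> S \<in> states \<and> u \<in> ?P \<and> matches S u" for S u
    by (simp add: arcs_def)
  have reindex: "(\<Sum>e\<in>prod.swap ` Z. g e) = (\<Sum>(u, S)\<in>Z. g (S, u))"
    for Z :: "(('a \<times> (nat \<Rightarrow> nat)) \<times> (nat \<times> nat \<Rightarrow> 'x)) set" and g :: "_ \<Rightarrow> nat"
    by (subst sum.reindex) (auto simp: case_prod_unfold prod.swap_def)
  have "arcs = prod.swap ` (SIGMA u:?P. {S \<in> states. matches S u})"
    by (force simp: arcs_def)
  from arg_cong[OF this, of "\<lambda>Z. \<Sum>e\<in>Z. card (conflicts arcs e)"]
  have "(\<Sum>e\<in>arcs. card (conflicts arcs e))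
      = (\<Sum>(u, S)\<in>(SIGMA u:?P. {S \<in> states. matches S u}). card (conflicts arcs (S, u)))"
    by (simp only: reindex)
  also have "\<dots> = (\<Sum>(u, S)\<in>(SIGMA u:?P. {S \<in> states. matches S u}).
      card {u' \<in> ?P. ?c u u' \<and> matches S u'})"
    by (intro sum.cong refl) (auto simp: conf in_arcs)
  also have "\<dots> = (\<Sum>u\<in>?P. \<Sum>S | S \<in> states \<and> matches S u. card {u' \<in> ?P. ?c u u' \<and> matches S u'})"
    using finP finite_states by (subst sum.Sigma) auto
  also have "\<dots> = (\<Sum>u\<in>?P. \<Sum>u' | u' \<in> ?P \<and> ?c u u'. card {S \<in> states. matches S u \<and> matches S u'})"
  proof (intro sum.cong refl)
    fix u :: "'a \<times> (nat \<Rightarrow> nat)"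
    have 1: "card {u' \<in> ?P. ?c u u' \<and> matches S u'} = (\<Sum>u' | u' \<in> ?P \<and> ?c u u'. of_bool (matches S u'))" for S
      using finP by (simp add: sum.If_cases of_bool_def Collect_conj_eq Int_assoc flip: card_eq_sum)
    have 2: "card {S \<in> states. matches S u \<and> matches S u'}
        = (\<Sum>S | S \<in> states \<and> matches S u. of_bool (matches S u'))" for u'
      using finite_states by (simp add: sum.If_cases of_bool_def Collect_conj_eq Int_assoc flip: card_eq_sum)
    show "(\<Sum>S | S \<in> states \<and> matches S u. card {u' \<in> ?P. ?c u u' \<and> matches S u'})
      = (\<Sum>u' | u' \<in> ?P \<and> ?c u u'. card {S \<in> states. matches S u \<and> matches S u'})"
      unfolding 1 2 by (rule sum.swap)
  qed
  finally show ?thesis .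
qed

text \<open>Classify the second arc by the set \<open>I\<close> of rows in which it uses the same
  column as the first. There are at most \<open>l ^ (s - card I)\<close> choices of columns, its
  pattern must agree on \<open>I\<close>, and matching it prescribes \<open>s - card I\<close>
  further cells; \<open>sparse\<close> says that these effects balance up to \<open>K\<close>. The
  factor \<open>2 ^ s\<close> counts the sets \<open>I\<close>.\<close>

lemma sum_conflicts_le:
  assumes sparse: "\<And>a I. a \<in> A \<Longrightarrow> I \<subseteq> {..<s} \<Longrightarrow>
      l ^ (s - card I) * card {a' \<in> A. acol a' \<inter> acol a \<noteq> {} \<and> (\<forall>i\<in>I. z a' i = z a i)}
        \<le> K * card X ^ (s - card I)"
  shows "(\<Sum>e\<in>arcs. card (conflicts arcs e)) \<le> (2 ^ s * K) * card arcs"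
proof -
  have bound: "(\<Sum>u' | u' \<in> A \<times> choices \<and> acol (fst u') \<inter> acol (fst u) \<noteq> {}.
       card {S \<in> states. matches S u \<and> matches S u'}) \<le> 2 ^ s * K * card X ^ (s * l - s)"
    if "u \<in> A \<times> choices" for u
  proof -
    obtain a J where u: "u = (a, J)" by (rule prod.exhaust)
    with that have a: "a \<in> A" and J: "J \<in> choices" by simp_all
    define T where "T = (\<lambda>I. {a' \<in> A. acol a' \<inter> acol a \<noteq> {} \<and> (\<forall>i\<in>I. z a' i = z a i)})"
    define Js where "Js = (\<lambda>I. {J' \<in> choices. {i. i < s \<and> J' i = J i} = I})"
    define h where "h = (\<lambda>u'. card {S \<in> states. matches S u \<and> matches S u'})"
    have finT: "finite (T I)" and finJs: "finite (Js I)" for I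
      using finA finite_choices by (auto simp: T_def Js_def)
    have h_eq: "h (a', J') = card X ^ (s * l - (2 * s - card I)) \<and> 2 * s - card I \<le> s * l \<and> a' \<in> T I"
      if "h (a', J') \<noteq> 0" "a' \<in> A" "acol a' \<inter> acol a \<noteq> {}" "J' \<in> Js I" for a' J' I
    proof -
      have J': "J' \<in> choices" and I: "I = {i. i < s \<and> J' i = J i}"
        using that(4) by (auto simp: Js_def)
      have "{S \<in> states. matches S (a, J) \<and> matches S (a', J')} \<noteq> {}"
        using that(1) unfolding h_def u by (metis card.empty)
      from card_matching_both[OF J J' a that(2) this]
      show ?thesis
        using that(2,3) by (simp add: h_def u T_def I)
    qed
    \<comment> \<open>If no pair in this class has a common state, the sum is zero; otherwise such a
      state shows \<open>2 * s - card I \<le> s * l\<close>, so that the exponents below are not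
      truncated.\<close>
    have part: "(\<Sum>u'\<in>T I \<times> Js I. h u') \<le> K * card X ^ (s * l - s)" if I: "I \<subseteq> {..<s}" for I
    proof (cases "\<exists>u'\<in>T I \<times> Js I. h u' \<noteq> 0")
      case False
      then have "(\<Sum>u'\<in>T I \<times> Js I. h u') = 0" by (intro sum.neutral) auto
      then show ?thesis by simp
    next
      case True
      then obtain a0 J0 where "h (a0, J0) \<noteq> 0" "a0 \<in> T I" "J0 \<in> Js I" by auto
      then have le: "2 * s - card I \<le> s * l"
        using h_eq by (auto simp: T_def)
      have cI: "card I \<le> s" using I card_mono[of "{..<s}" I] by simp
      have "card (Js I) \<le> card {J' \<in> {..<s} \<rightarrow>\<^sub>E {..<l}. \<forall>i\<in>I. J' i = J i}"
        using finite_choices by (intro card_mono) (auto simp: Js_def choices_def)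
      also have "\<dots> = card {..<l} ^ (card {..<s} - card I)"
        using I choices_less[OF J] by (intro card_PiE_extending) auto
      finally have cJ: "card (Js I) \<le> l ^ (s - card I)" by simp
      have "(\<Sum>u'\<in>T I \<times> Js I. h u') \<le> (\<Sum>u'\<in>T I \<times> Js I. card X ^ (s * l - (2 * s - card I)))"
      proof (intro sum_mono)
        fix u' assume u': "u' \<in> T I \<times> Js I"
        obtain a' J' where eq: "u' = (a', J')" by fastforce
        show "h u' \<le> card X ^ (s * l - (2 * s - card I))"
          using h_eq[of a' J' I] u' unfolding eq by (cases "h (a', J') = 0") (auto simp: T_def)
      qed
      also have "\<dots> = card (Js I) * card (T I) * card X ^ (s * l - (2 * s - card I))"
        by (simp add: card_cartesian_product)
      also have "\<dots> \<le> (l ^ (s - card I) * card (T I)) * card X ^ (s * l - (2 * s - card I))"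
        using cJ by (intro mult_right_mono) auto
      also have "\<dots> \<le> (K * card X ^ (s - card I)) * card X ^ (s * l - (2 * s - card I))"
        using sparse[OF a I] unfolding T_def by (intro mult_right_mono) auto
      also have "\<dots> = K * card X ^ (s * l - s)"
      proof -
        have "(s - card I) + (s * l - (2 * s - card I)) = s * l - s"
          using le cI by linarith
        then show ?thesis by (simp add: power_add[symmetric])
      qed
      finally show ?thesis .
    qed
    let ?Z = "{u' \<in> A \<times> choices. acol (fst u') \<inter> acol (fst u) \<noteq> {}}"
    have finZ: "finite ?Z" using finA finite_choices by simp
    define cls where "cls = (\<lambda>u' :: 'a \<times> (nat \<Rightarrow> nat). {i. i < s \<and> snd u' i = J i})"
    have "(\<Sum>u'\<in>?Z. h u') = (\<Sum>I\<in>Pow {..<s}. \<Sum>u' | u' \<in> ?Z \<and> cls u' = I. h u')"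
      by (rule sum.group[symmetric]) (use finZ in \<open>auto simp: cls_def\<close>)
    also have "\<dots> \<le> (\<Sum>I\<in>Pow {..<s}. \<Sum>u'\<in>T I \<times> Js I. h u')"
    proof (intro sum_mono)
      fix I
      let ?Z' = "{u' \<in> ?Z. cls u' = I}"
      have "u' \<in> T I \<times> Js I" if "u' \<in> ?Z'" "h u' \<noteq> 0" for u'
      proof -
        obtain a' J' where eq: "u' = (a', J')" by (rule prod.exhaust)
        have "J' \<in> Js I" "a' \<in> A" "acol a' \<inter> acol a \<noteq> {}"
          using that(1) by (auto simp: Js_def cls_def eq u)
        then show ?thesis
          using h_eq[of a' J' I] that(2) by (simp add: eq)
      qed
      then have "sum h ?Z' = sum h (?Z' \<inter> T I \<times> Js I)"
      proof (intro sum.mono_neutral_right)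
        show "finite ?Z'" by (rule finite_subset[OF _ finZ]) auto
      qed auto
      also have "\<dots> \<le> sum h (T I \<times> Js I)"
        using finT finJs by (intro sum_mono2) auto
      finally show "sum h ?Z' \<le> sum h (T I \<times> Js I)" .
    qed
    also have "\<dots> \<le> (\<Sum>I\<in>Pow {..<s}. K * card X ^ (s * l - s))"
      by (intro sum_mono part) auto
    also have "\<dots> = 2 ^ s * K * card X ^ (s * l - s)"
      by (simp add: card_Pow)
    finally show ?thesis by (simp add: h_def)
  qed
  have "(\<Sum>e\<in>arcs. card (conflicts arcs e)) \<le> (\<Sum>u\<in>A \<times> choices. 2 ^ s * K * card X ^ (s * l - s))"
    unfolding sum_card_conflicts by (intro sum_mono bound)
  also have "\<dots> = (2 ^ s * K) * card arcs"
    by (simp add: card_arcs card_cartesian_product card_choices)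
  finally show ?thesis .
qed

text \<open>Vertices and arcs both carry the factor \<open>card X ^ (s * l - s)\<close>; dividing by
  it turns the condition on the average degree into one on the number of steps.\<close>

theorem two_walks:
  assumes "X \<noteq> {}" "0 < l"
    and col: "\<And>a. a \<in> A \<Longrightarrow> finite (acol a) \<and> card (acol a) \<le> 3"
    and key: "\<And>a. a \<in> A \<Longrightarrow> key a \<in> acol a"
    and sparse: "\<And>a I. a \<in> A \<Longrightarrow> I \<subseteq> {..<s} \<Longrightarrow>
      l ^ (s - card I) * card {a' \<in> A. acol a' \<inter> acol a \<noteq> {} \<and> (\<forall>i\<in>I. z a' i = z a i)}
        \<le> K * card X ^ (s - card I)"
    and large: "4 * (d + 3 * r * (4 * (2 ^ s * K))) * card X ^ s < card A * l ^ s"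
    and d: "card X ^ (s * l) * (r * (4 * (2 ^ s * K))) ^ r < d ^ r"
  obtains S p p' where "set p \<subseteq> arcs" "set p' \<subseteq> arcs" "length p = r" "length p' = r"
    "rainbow S {} p" "rainbow S {} p'" "endpoint S p = endpoint S p'"
    "(\<lambda>(S, u). key (fst u)) ` set p \<noteq> (\<lambda>(S, u). key (fst u)) ` set p'"
proof (rule two_walks_of_few_conflicts[where V = states and E = arcs and opp = reversal
      and key = "\<lambda>(S, u). key (fst u)" and K = "2 ^ s * K" and d = d and r = r])
  show "(\<Sum>e\<in>arcs. card (conflicts arcs e)) \<le> 2 ^ s * K * card arcs"
    by (rule sum_conflicts_le[OF sparse])
  have X: "0 < card X" using finX assms(1) by (simp add: card_gt_0_iff)
  have "s + (s * l - s) = s * l" using \<open>0 < l\<close> by (cases l) auto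
  then have "card states = card X ^ s * card X ^ (s * l - s)"
    by (simp only: card_states power_add[symmetric])
  moreover have "4 * (d + 3 * r * (4 * (2 ^ s * K))) * card X ^ s * card X ^ (s * l - s)
      < card A * l ^ s * card X ^ (s * l - s)"
    using large X by simp
  ultimately show "4 * (d + 3 * r * (4 * (2 ^ s * K))) * card states < card arcs"
    by (simp only: card_arcs mult.assoc)
  show "card states * (r * (4 * (2 ^ s * K))) ^ r < d ^ r"
    using d by (simp only: card_states)
  show "reversal e \<in> arcs" "reversal (reversal e) = e" "fst (reversal e) = (case e of (S, u) \<Rightarrow> move S u)"
    if "e \<in> arcs" for e
    using reversal[OF that] by simp_all
  show "fst e \<in> states" "finite (case e of (S, u) \<Rightarrow> acol (fst u)) \<and> card (case e of (S, u) \<Rightarrow> acol (fst u)) \<le> 3"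
    "(case e of (S, u) \<Rightarrow> key (fst u)) \<in> (case e of (S, u) \<Rightarrow> acol (fst u))" if "e \<in> arcs" for e
    using that col key by (auto simp: arcs_def)
qed (use finite_states finite_arcs that in auto)

end

section \<open>Kikuchi graphs over a finite field\<close>

lemma (in abelian_group) add_eq_iff_eq_minus:
  assumes "a \<in> carrier G" "b \<in> carrier G" "c \<in> carrier G"
  shows "a \<oplus> b = c \<longleftrightarrow> a = c \<ominus> b"
proof
  assume "a \<oplus> b = c"
  then show "a = c \<ominus> b" using assms by (auto simp: a_minus_def a_assoc r_neg)
next
  assume "a = c \<ominus> b"
  then show "a \<oplus> b = c" using assms by (auto simp: a_minus_def a_assoc l_neg)
qed

lemma (in abelian_group) finsum_diff:
  assumes "f \<in> A \<rightarrow> carrier G" "g \<in> A \<rightarrow> carrier G"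
  shows "(\<Oplus>i\<in>A. f i \<ominus> g i) = finsum G f A \<ominus> finsum G g A"
proof -
  have fg: "(\<lambda>i. f i \<ominus> g i) \<in> A \<rightarrow> carrier G"
    using assms by (auto simp: Pi_iff)
  have "(\<Oplus>i\<in>A. (f i \<ominus> g i) \<oplus> g i) = finsum G f A"
    using assms by (intro add.finprod_cong') (auto simp: Pi_iff a_minus_def a_assoc l_neg)
  then have "(\<Oplus>i\<in>A. f i \<ominus> g i) \<oplus> finsum G g A = finsum G f A"
    using finsum_addf[OF fg assms(2)] by simp
  then show ?thesis
    by (subst add_eq_iff_eq_minus[symmetric])
      (use finsum_closed[OF fg] finsum_closed[OF assms(1)] finsum_closed[OF assms(2)] in auto)
qed

lemma (in abelian_group) finsum_if_eq:
  assumes "finite A" "inj_on h A" "v \<in> carrier G"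
  shows "(\<Oplus>j\<in>A. if h j = i then v else \<zero>) = (if i \<in> h ` A then v else \<zero>)"
proof (cases "i \<in> h ` A")
  case True
  then obtain j where j: "j \<in> A" "i = h j" by blast
  have "(\<Oplus>k\<in>A. if h k = i then v else \<zero>) = (\<Oplus>k\<in>A. if j = k then v else \<zero>)"
    using assms j by (intro add.finprod_cong') (auto simp: inj_on_def)
  also have "\<dots> = v"
    using finsum_singleton[of j A "\<lambda>_. v"] assms j by auto
  finally show ?thesis using True by simp
next
  case False
  then have "(\<Oplus>k\<in>A. if h k = i then v else \<zero>) = \<zero>"
    by (intro add.finprod_one_eqI) auto
  then show ?thesis using False by simp
qed

text \<open>The enumeration \<open>en x\<close> is arbitrary; it assigns a row of the array to each
  nonzero coordinate of \<open>f x\<close> outside the base. \<open>s1\<close> is where a pattern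
  passes from its first vector to its second.\<close>

locale kikuchi = field R for R (structure) +
  fixes n l s s1 :: nat and M :: "'b set" and grp :: "'b \<Rightarrow> 'g" and base :: "'g \<Rightarrow> nat set"
    and f :: "'b \<Rightarrow> nat \<Rightarrow> 'a" and en :: "'b \<Rightarrow> nat \<Rightarrow> nat"
  assumes finite_carrier: "finite (carrier R)" and finM: "finite M"
    and f_closed: "x \<in> M \<Longrightarrow> i < n \<Longrightarrow> f x i \<in> carrier R"
    and f_base: "x \<in> M \<Longrightarrow> y \<in> M \<Longrightarrow> grp x = grp y \<Longrightarrow> i \<in> base (grp x) \<Longrightarrow> f x i = f y i"
    and en: "x \<in> M \<Longrightarrow> bij_betw (en x) {..<s} {i. i < n \<and> i \<notin> base (grp x) \<and> f x i \<noteq> \<zero>}"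
begin

abbreviation nz :: "'a set" where "nz \<equiv> nonzero_elems R"

lemma nz_iff: "c \<in> nz \<longleftrightarrow> c \<in> carrier R \<and> c \<noteq> \<zero>"
  by (simp add: nonzero_elems_def)

lemma finite_nz: "finite nz"
  using finite_carrier by (simp add: nonzero_elems_def)

lemma nz_minus: "c \<in> nz \<Longrightarrow> \<ominus> c \<in> nz"
  by (auto simp: nz_iff)

lemma en_props:
  assumes "x \<in> M" "i < s"
  shows "en x i < n" "en x i \<notin> base (grp x)" "f x (en x i) \<in> nz"
  using bij_betwE[OF en[OF assms(1)]] assms f_closed by (auto simp: nz_iff)

definition cell :: "'a \<Rightarrow> 'b \<Rightarrow> nat \<Rightarrow> nat \<times> 'a" where
  "cell c x i = (en x i, c \<otimes> f x (en x i))"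

lemma cell_in:
  assumes "c \<in> nz" "x \<in> M" "i < s"
  shows "cell c x i \<in> {..<n} \<times> nz"
  using en_props[OF assms(2,3)] assms(1) integral by (auto simp: cell_def nz_iff)

definition steps :: "('a \<times> 'b \<times> 'b) set" where
  "steps = {(c, x, y). c \<in> nz \<and> x \<in> M \<and> y \<in> M \<and> grp x = grp y \<and> x \<noteq> y}"

lemma steps_iff: "(c, x, y) \<in> steps \<longleftrightarrow> c \<in> nz \<and> x \<in> M \<and> y \<in> M \<and> grp x = grp y \<and> x \<noteq> y"
  by (simp add: steps_def)

definition opposite :: "'a \<times> 'b \<times> 'b \<Rightarrow> 'a \<times> 'b \<times> 'b" where
  "opposite = (\<lambda>(c, x, y). (c, y, x))"

text \<open>Overwriting this pattern by that of the opposite step adds \<open>c * (f y - f x)\<close> to the vector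
  encoded by a state: the base coordinates cancel and need not occur in the pattern.\<close>

definition pattern :: "'a \<times> 'b \<times> 'b \<Rightarrow> nat \<Rightarrow> nat \<times> 'a" where
  "pattern = (\<lambda>(c, x, y) i. if i < s1 then cell c x i else cell (\<ominus> c) y i)"

lemma pattern_less: "i < s1 \<Longrightarrow> pattern (c, x, y) i = cell c x i"
  and pattern_ge: "\<not> i < s1 \<Longrightarrow> pattern (c, x, y) i = cell (\<ominus> c) y i"
  by (simp_all add: pattern_def)

text \<open>The scalar enters as \<open>{c, \<ominus> c}\<close> because it is recovered from the
  coefficient of a vector, whose sign depends on which end of the step the vector is.\<close>

definition label :: "'a \<times> 'b \<times> 'b \<Rightarrow> ('g \<times> 'a set) + 'b" where
  "label = (\<lambda>(c, x, y). Inl (grp x, {c, \<ominus> c}))"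

text \<open>The two vectors are colours so that no vector occurs twice on a rainbow walk; the label
  is one in order to bound the number of walks with prescribed labels.\<close>

definition colours :: "'a \<times> 'b \<times> 'b \<Rightarrow> (('g \<times> 'a set) + 'b) set" where
  "colours = (\<lambda>(c, x, y). {Inl (grp x, {c, \<ominus> c}), Inr x, Inr y})"

lemma finite_steps: "finite steps"
  by (rule finite_subset[of _ "nz \<times> M \<times> M"]) (auto simp: steps_def finite_nz finM)

sublocale tuple_graph "{..<n} \<times> nz" l s steps opposite pattern colours
proof
  show "finite ({..<n} \<times> nz)" using finite_nz by simp
  show "finite steps" by (rule finite_steps)
  show "pattern a i \<in> {..<n} \<times> nz" if "a \<in> steps" "i < s" for a i
    using that by (auto simp: steps_def pattern_def cell_in nz_minus)
  show "opposite a \<in> steps" if "a \<in> steps" for a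
    using that by (auto simp: steps_def opposite_def)
  show "opposite (opposite a) = a" for a
    by (simp add: opposite_def case_prod_unfold)
qed

lemma arcs_iff: "(S, a, J) \<in> arcs \<longleftrightarrow> S \<in> states \<and> a \<in> steps \<and> J \<in> choices \<and> matches S (a, J)"
  by (simp add: arcs_def)

lemma states_nz: "S \<in> states \<Longrightarrow> p \<in> pos \<Longrightarrow> snd (S p) \<in> carrier R"
  using states_in[of S p] by (auto simp: nz_iff mem_Times_iff)

section \<open>Effect of a move on the encoded vector\<close>

definition encoded :: "(nat \<times> nat \<Rightarrow> nat \<times> 'a) \<Rightarrow> nat \<Rightarrow> 'a" where
  "encoded S i = (\<Oplus>p\<in>pos. if fst (S p) = i then snd (S p) else \<zero>)"

lemma encoded_closed: "S \<in> states \<Longrightarrow> encoded S i \<in> carrier R"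
  unfolding encoded_def by (rule finsum_closed) (auto simp: states_nz)

lemma sum_cells:
  assumes "x \<in> M" "c \<in> nz" "i < n"
  shows "(\<Oplus>j\<in>{..<s}. if en x j = i then c \<otimes> f x i else \<zero>)
    = (if i \<in> base (grp x) then \<zero> else c \<otimes> f x i)"
proof -
  have "(\<Oplus>j\<in>{..<s}. if en x j = i then c \<otimes> f x i else \<zero>)
      = (if i \<in> en x ` {..<s} then c \<otimes> f x i else \<zero>)"
    using assms en[OF assms(1)] f_closed
    by (intro finsum_if_eq) (auto simp: bij_betw_def nz_iff)
  also have "en x ` {..<s} = {i. i < n \<and> i \<notin> base (grp x) \<and> f x i \<noteq> \<zero>}"
    using en[OF assms(1)] by (simp add: bij_betw_def)
  finally show ?thesis
    using assms by (auto simp: nz_iff)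
qed

text \<open>Row \<open>j\<close> contributes its entry of \<open>c y\<close> minus its entry of
  \<open>c x\<close>: in the first \<open>s1\<close> rows \<open>c x\<close> is replaced by
  \<open>c y\<close>, in the others \<open>- c y\<close> by \<open>- c x\<close>. Base coordinates
  do not occur in the patterns, and there the asserted change is zero because \<open>f x\<close> and
  \<open>f y\<close> agree.\<close>

lemma encoded_move:
  assumes S: "S \<in> states" and a: "(c, x, y) \<in> steps" and J: "J \<in> choices"
    and match: "matches S ((c, x, y), J)" and i: "i < n"
  shows "encoded (move S ((c, x, y), J)) i = encoded S i \<oplus> (c \<otimes> f y i \<ominus> c \<otimes> f x i)"
proof -
  let ?S = "move S ((c, x, y), J)"
  have c: "c \<in> nz" "c \<in> carrier R" and xy: "x \<in> M" "y \<in> M" "grp x = grp y"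
    using a by (auto simp: steps_iff nz_iff)
  have fx: "f x i \<in> carrier R" "f y i \<in> carrier R"
    using xy i f_closed by auto
  have S': "?S \<in> states"
    using move_in_states[OF S] a J by simp
  define g where "g = (\<lambda>S (p :: nat \<times> nat). if fst (S p :: nat \<times> 'a) = i then snd (S p) else \<zero>)"
  have g: "g T \<in> pos \<rightarrow> carrier R" if "T \<in> states" for T
    using states_nz[OF that] by (auto simp: g_def)
  define u where "u = (\<lambda>w j. if en w j = i then c \<otimes> f w i else \<zero>)"
  have u: "u w \<in> {..<s} \<rightarrow> carrier R" if "w \<in> {x, y}" for w
    using that fx c by (auto simp: u_def)
  have step: "g ?S (j, J j) \<ominus> g S (j, J j) = u y j \<ominus> u x j" if "j < s" for j
  proof -
    have Sj: "S (j, J j) = pattern (c, x, y) j"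
      using match that by (simp add: matches_def)
    have S'j: "?S (j, J j) = pattern (c, y, x) j"
      using matches_move[OF J, of S "(c, x, y)"] that by (simp add: matches_def opposite_def)
    have cl: "u x j \<in> carrier R" "u y j \<in> carrier R"
      using u that by auto
    show ?thesis
    proof (cases "j < s1")
      case True
      then show ?thesis
        by (auto simp: g_def Sj S'j pattern_less pattern_ge cell_def u_def)
    next
      case False
      have "g ?S (j, J j) = \<ominus> u x j" "g S (j, J j) = \<ominus> u y j"
        using False fx c by (auto simp: g_def Sj S'j pattern_less pattern_ge cell_def u_def l_minus)
      then show ?thesis
        using cl by (simp add: a_minus_def a_comm)
    qed
  qed
  have "encoded ?S i \<ominus> encoded S i = (\<Oplus>p\<in>pos. g ?S p \<ominus> g S p)"
    unfolding encoded_def g_def[symmetric, THEN fun_cong, THEN fun_cong]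
    using finsum_diff[OF g[OF S'] g[OF S]] by (simp add: g_def)
  also have "\<dots> = (\<Oplus>p\<in>spots J. g ?S p \<ominus> g S p)"
  proof (rule add.finprod_mono_neutral_cong_right)
    show "finite pos" by (rule finite_pos)
    show "spots J \<subseteq> pos" by (rule spots_subset[OF J])
    show "g ?S p \<ominus> g S p = \<zero>" if "p \<in> pos - spots J" for p
    proof -
      have "?S p = S p" using that by (cases p) (auto simp: move_def pos_def)
      then show ?thesis using g[OF S] that by (auto simp: g_def Pi_iff a_minus_def r_neg)
    qed
    show "(\<lambda>p. g ?S p \<ominus> g S p) \<in> pos \<rightarrow> carrier R"
      using g[OF S] g[OF S'] by (auto simp: Pi_iff)
  qed auto
  also have "\<dots> = (\<Oplus>j\<in>{..<s}. g ?S (j, J j) \<ominus> g S (j, J j))"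
  proof (rule finsum_reindex)
    show "inj_on (\<lambda>j. (j, J j)) {..<s}" by (auto simp: inj_on_def)
    show "(\<lambda>p. g ?S p \<ominus> g S p) \<in> spots J \<rightarrow> carrier R"
      using g[OF S] g[OF S'] spots_subset[OF J] by (auto simp: Pi_iff)
  qed
  also have "\<dots> = (\<Oplus>j\<in>{..<s}. u y j \<ominus> u x j)"
    using step u by (intro add.finprod_cong') (auto simp: Pi_iff)
  also have "\<dots> = finsum R (u y) {..<s} \<ominus> finsum R (u x) {..<s}"
    by (rule finsum_diff) (use u in auto)
  also have "finsum R (u y) {..<s} = (if i \<in> base (grp y) then \<zero> else c \<otimes> f y i)"
    unfolding u_def by (rule sum_cells[OF xy(2) c(1) i])
  also have "finsum R (u x) {..<s} = (if i \<in> base (grp x) then \<zero> else c \<otimes> f x i)"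
    unfolding u_def by (rule sum_cells[OF xy(1) c(1) i])
  also have "(if i \<in> base (grp y) then \<zero> else c \<otimes> f y i) \<ominus> (if i \<in> base (grp x) then \<zero> else c \<otimes> f x i)
      = c \<otimes> f y i \<ominus> c \<otimes> f x i"
    using xy f_base[of x y i] fx c by (auto simp: a_minus_def r_neg)
  finally have "encoded ?S i \<ominus> encoded S i = c \<otimes> f y i \<ominus> c \<otimes> f x i" .
  then have "(c \<otimes> f y i \<ominus> c \<otimes> f x i) \<oplus> encoded S i = encoded ?S i"
    by (subst add_eq_iff_eq_minus) (use encoded_closed[OF S, of i] encoded_closed[OF S', of i] fx c in auto)
  then show ?thesis
    using encoded_closed[OF S, of i] fx c by (simp add: a_comm)
qed

section \<open>Linear combinations along walks\<close>

primrec coeffs :: "((nat \<times> nat \<Rightarrow> nat \<times> 'a) \<times> ('a \<times> 'b \<times> 'b) \<times> (nat \<Rightarrow> nat)) list \<Rightarrow> 'b \<Rightarrow> 'a" where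
  "coeffs [] w = \<zero>"
| "coeffs (e # p) w = (case e of (S, (c, x, y), J) \<Rightarrow>
     coeffs p w \<oplus> ((if w = y then c else \<zero>) \<ominus> (if w = x then c else \<zero>)))"

lemma coeffs_closed: "set p \<subseteq> arcs \<Longrightarrow> coeffs p w \<in> carrier R"
  by (induction p) (auto simp: arcs_iff steps_iff nz_iff)

lemma encoded_endpoint:
  assumes "set p \<subseteq> arcs" "rainbow S C p" "S \<in> states" "i < n"
  shows "encoded (endpoint S p) i = encoded S i \<oplus> (\<Oplus>w\<in>M. coeffs p w \<otimes> f w i)"
  using assms
proof (induction p arbitrary: S C)
  case Nil
  have "(\<Oplus>w\<in>M. \<zero> \<otimes> f w i) = \<zero>"
    using f_closed Nil.prems by (intro add.finprod_one_eqI) auto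
  then show ?case using encoded_closed[OF Nil.prems(3)] by simp
next
  case (Cons e p)
  obtain S' c x y J where "e = (S', (c, x, y), J)" by (metis prod.exhaust)
  with Cons.prems have e: "e = (S, (c, x, y), J)" by simp
  let ?S = "move S ((c, x, y), J)"
  have a: "(c, x, y) \<in> steps" "J \<in> choices" "matches S ((c, x, y), J)"
    using Cons.prems(1) by (auto simp: e arcs_iff)
  have c: "c \<in> carrier R" "x \<in> M" "y \<in> M" using a(1) by (auto simp: steps_iff nz_iff)
  have fi: "(\<lambda>w. f w i) \<in> M \<rightarrow> carrier R" using f_closed Cons.prems(4) by auto
  have S': "?S \<in> states" using move_in_states[OF Cons.prems(3)] a by simp
  have single: "(\<Oplus>w\<in>M. if w = v then c \<otimes> f v i else \<zero>) = c \<otimes> f v i" if "v \<in> M" for v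
    using finsum_if_eq[OF finM inj_on_id2, of "c \<otimes> f v i" v] that c fi by auto
  have cp: "coeffs p w \<in> carrier R" for w
    using coeffs_closed Cons.prems(1) by simp
  have "(\<Oplus>w\<in>M. coeffs (e # p) w \<otimes> f w i) = (\<Oplus>w\<in>M. coeffs p w \<otimes> f w i \<oplus>
      ((if w = y then c \<otimes> f y i else \<zero>) \<ominus> (if w = x then c \<otimes> f x i else \<zero>)))"
  proof (rule add.finprod_cong')
    show "(\<lambda>w. coeffs p w \<otimes> f w i \<oplus>
      ((if w = y then c \<otimes> f y i else \<zero>) \<ominus> (if w = x then c \<otimes> f x i else \<zero>))) \<in> M \<rightarrow> carrier R"
      using fi c cp by (auto simp: Pi_iff)
    fix w assume "w \<in> M"
    then have "f w i \<in> carrier R" using fi by auto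
    then show "coeffs (e # p) w \<otimes> f w i = coeffs p w \<otimes> f w i \<oplus>
      ((if w = y then c \<otimes> f y i else \<zero>) \<ominus> (if w = x then c \<otimes> f x i else \<zero>))"
      using c cp[of w] by (auto simp: e a_minus_def l_distr l_minus)
  qed simp
  also have "\<dots> = (\<Oplus>w\<in>M. coeffs p w \<otimes> f w i) \<oplus>
      (\<Oplus>w\<in>M. (if w = y then c \<otimes> f y i else \<zero>) \<ominus> (if w = x then c \<otimes> f x i else \<zero>))"
    by (rule finsum_addf) (use fi c cp in \<open>auto simp: Pi_iff\<close>)
  also have "(\<Oplus>w\<in>M. (if w = y then c \<otimes> f y i else \<zero>) \<ominus> (if w = x then c \<otimes> f x i else \<zero>))
      = c \<otimes> f y i \<ominus> c \<otimes> f x i"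
    using single[OF c(2)] single[OF c(3)] fi c by (subst finsum_diff) (auto simp: Pi_iff)
  finally have sum: "(\<Oplus>w\<in>M. coeffs (e # p) w \<otimes> f w i)
      = (\<Oplus>w\<in>M. coeffs p w \<otimes> f w i) \<oplus> (c \<otimes> f y i \<ominus> c \<otimes> f x i)" .
  have "encoded (endpoint S (e # p)) i = encoded ?S i \<oplus> (\<Oplus>w\<in>M. coeffs p w \<otimes> f w i)"
    using Cons.IH[of ?S "C \<union> colours (c, x, y)"] Cons.prems S' by (simp add: e)
  also have "encoded ?S i = encoded S i \<oplus> (c \<otimes> f y i \<ominus> c \<otimes> f x i)"
    by (rule encoded_move) (use a Cons.prems in auto)
  finally show ?case
    unfolding sum using encoded_closed[OF Cons.prems(3), of i] fi c cp
    by (simp add: a_ac Pi_iff)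
qed

lemma coeffs_nonzero:
  assumes "set p \<subseteq> arcs" "coeffs p w \<noteq> \<zero>"
  obtains S c x y J where "(S, (c, x, y), J) \<in> set p" "w \<in> {x, y}"
proof -
  have "\<exists>e\<in>set p. w \<in> {fst (snd (fst (snd e))), snd (snd (fst (snd e)))}"
    using assms by (induction p) (auto split: if_splits simp: a_minus_def coeffs_closed)
  then show ?thesis using that by fastforce
qed

lemma rainbow_avoids: "rainbow S C p \<Longrightarrow> (T, u) \<in> set p \<Longrightarrow> colours (fst u) \<inter> C = {}"
  by (induction p arbitrary: S C) auto

lemma coeffs_avoided:
  assumes "set p \<subseteq> arcs" "rainbow S C p" "Inr w \<in> C"
  shows "coeffs p w = \<zero>"
proof (rule ccontr)
  assume "coeffs p w \<noteq> \<zero>"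
  then obtain S' c x y J where e: "(S', (c, x, y), J) \<in> set p" "w \<in> {x, y}"
    using coeffs_nonzero assms(1) by blast
  then show False
    using rainbow_avoids[OF assms(2) e(1)] assms(3) by (auto simp: colours_def)
qed

text \<open>A vector is a colour of the arcs that use it, so on a rainbow walk no second arc touches
  \<open>w\<close>, and contributions of several arcs cannot cancel. Within one arc
  \<open>x \<noteq> y\<close> excludes cancellation.\<close>

lemma coeffs_on_arc:
  assumes "set p \<subseteq> arcs" "rainbow S C p" "(S', (c, x, y), J) \<in> set p" "w \<in> {x, y}"
  shows "coeffs p w \<in> {c, \<ominus> c}"
  using assms(1-3)
proof (induction p arbitrary: S C)
  case (Cons e p)
  obtain T c' x' y' J' where e: "e = (T, (c', x', y'), J')" by (metis prod.exhaust)
  have rb: "rainbow (move T ((c', x', y'), J')) (C \<union> colours (c', x', y')) p"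
    using Cons.prems(2) by (auto simp: e)
  have c': "c' \<in> carrier R" "x' \<noteq> y'"
    using Cons.prems(1) by (auto simp: e arcs_iff steps_iff nz_iff)
  show ?case
  proof (cases "(S', (c, x, y), J) = e")
    case True
    then have w: "w \<in> {x', y'}" and "c = c'" using assms(4) e by auto
    have "coeffs p w = \<zero>"
      by (rule coeffs_avoided[OF _ rb]) (use Cons.prems(1) w in \<open>auto simp: colours_def\<close>)
    then show ?thesis
      using w \<open>c = c'\<close> c' by (auto simp: e a_minus_def)
  next
    case False
    then have p: "(S', (c, x, y), J) \<in> set p" using Cons.prems(3) by auto
    have "coeffs p w \<in> {c, \<ominus> c}"
      using Cons.IH[OF _ rb p] Cons.prems(1) by simp
    moreover have "w \<notin> {x', y'}"
      using rainbow_avoids[OF rb p] assms(4) by (auto simp: colours_def)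
    ultimately show ?thesis
      using Cons.prems(1) coeffs_closed[of p w] by (auto simp: e a_minus_def)
  qed
qed simp

text \<open>If all coefficients agreed, every label on one walk would occur on the other: the vector
  \<open>x\<close> of its arc has coefficient \<open>c\<close> or \<open>\<ominus> c\<close>, so it
  is used on the other walk as well, with the same scalar up to sign and, being the same vector, in
  the same group. Two walks of length \<open>r\<close> with two vectors per arc use at most
  \<open>4 * r\<close> vectors.\<close>

lemma dependency_of_walks:
  assumes p: "set p \<subseteq> arcs" "rainbow S {} p" "length p = r"
    and p': "set p' \<subseteq> arcs" "rainbow S {} p'" "length p' = r"
    and "endpoint S p = endpoint S p'"
    and diff: "(\<lambda>(S, u). label (fst u)) ` set p \<noteq> (\<lambda>(S, u). label (fst u)) ` set p'"
  obtains V \<beta> where "V \<noteq> {}" "V \<subseteq> M" "card V \<le> 4 * r" "\<beta> \<in> V \<rightarrow> nz"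
    "\<And>i. i < n \<Longrightarrow> (\<Oplus>w\<in>V. \<beta> w \<otimes> f w i) = \<zero>"
proof -
  define \<beta> where "\<beta> = (\<lambda>w. coeffs p w \<ominus> coeffs p' w)"
  define V where "V = {w \<in> M. \<beta> w \<noteq> \<zero>}"
  have cl: "coeffs p w \<in> carrier R" "coeffs p' w \<in> carrier R" for w
    using coeffs_closed p(1) p'(1) by auto
  have "p \<noteq> [] \<or> p' \<noteq> []" using diff by auto
  then have S: "S \<in> states"
    using p p' by (cases p; cases p') (auto simp: arcs_iff)
  have witness: "\<exists>w\<in>M. coeffs P w \<noteq> coeffs P' w"
    if P: "set P \<subseteq> arcs" "rainbow S {} P" and P': "set P' \<subseteq> arcs" "rainbow S {} P'"
      and \<kappa>: "\<kappa> \<in> (\<lambda>(S, u). label (fst u)) ` set P" "\<kappa> \<notin> (\<lambda>(S, u). label (fst u)) ` set P'" for P P' \<kappa>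
  proof -
    obtain T c x y J where e: "(T, (c, x, y), J) \<in> set P" and \<kappa>eq: "\<kappa> = label (c, x, y)"
      using \<kappa>(1) by auto
    have c: "c \<in> nz" "x \<in> M" using e P(1) by (auto simp: arcs_iff steps_iff)
    have x: "coeffs P x \<in> {c, \<ominus> c}" by (rule coeffs_on_arc[OF P e]) simp
    have "coeffs P' x \<noteq> coeffs P x"
    proof
      assume eq: "coeffs P' x = coeffs P x"
      then have "coeffs P' x \<noteq> \<zero>" using x c nz_minus[of c] by (auto simp: nz_iff)
      then obtain T' c' x' y' J' where e': "(T', (c', x', y'), J') \<in> set P'" "x \<in> {x', y'}"
        using coeffs_nonzero P'(1) by blast
      have st: "(c', x', y') \<in> steps" using e' P'(1) by (auto simp: arcs_iff)
      then have "grp x = grp x'" "c' \<in> carrier R" using e'(2) by (auto simp: steps_iff nz_iff)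
      moreover have "coeffs P x \<in> {c', \<ominus> c'}"
        using coeffs_on_arc[OF P' e'] eq by simp
      then have "c' = c \<or> c' = \<ominus> c"
        using x c \<open>c' \<in> carrier R\<close> minus_minus by (metis insert_iff empty_iff nz_iff)
      then have "{c, \<ominus> c} = {c', \<ominus> c'}"
        using c by (auto simp: nz_iff)
      ultimately have "label (c', x', y') = \<kappa>"
        by (simp add: \<kappa>eq label_def)
      then show False using \<kappa>(2) e'(1) by force
    qed
    then show ?thesis using c by metis
  qed
  obtain \<kappa> where "\<kappa> \<in> (\<lambda>(S, u). label (fst u)) ` set p \<and> \<kappa> \<notin> (\<lambda>(S, u). label (fst u)) ` set p'
      \<or> \<kappa> \<in> (\<lambda>(S, u). label (fst u)) ` set p' \<and> \<kappa> \<notin> (\<lambda>(S, u). label (fst u)) ` set p"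
    using diff by blast
  then obtain w where w: "w \<in> M" "coeffs p w \<noteq> coeffs p' w"
    using witness[OF p(1,2) p'(1,2)] witness[OF p'(1,2) p(1,2)] by metis
  then have "\<beta> w \<noteq> \<zero>"
    using cl[of w] add_eq_iff_eq_minus[OF zero_closed cl(2)[of w] cl(1)[of w]] by (simp add: \<beta>_def)
  with w have "V \<noteq> {}"
    by (auto simp: V_def)
  moreover have "card V \<le> 4 * r"
  proof -
    define ends :: "(nat \<times> nat \<Rightarrow> nat \<times> 'a) \<times> ('a \<times> 'b \<times> 'b) \<times> (nat \<Rightarrow> nat) \<Rightarrow> 'b set"
      where "ends = (\<lambda>(S, (c, x, y), J). {x, y})"
    have supp: "w \<in> (\<Union>e\<in>set q. ends e)" if q: "set q \<subseteq> arcs" "coeffs q w \<noteq> \<zero>" for q w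
    proof -
      obtain S c x y J where "(S, (c, x, y), J) \<in> set q" "w \<in> {x, y}"
        by (rule coeffs_nonzero[OF q])
      then show ?thesis by (intro UN_I[of "(S, (c, x, y), J)"]) (simp_all add: ends_def)
    qed
    have "V \<subseteq> (\<Union>e\<in>set p \<union> set p'. ends e)"
    proof
      fix w assume "w \<in> V"
      then have "coeffs p w \<noteq> \<zero> \<or> coeffs p' w \<noteq> \<zero>"
        by (auto simp: V_def \<beta>_def a_minus_def)
      then show "w \<in> (\<Union>e\<in>set p \<union> set p'. ends e)"
        using supp[OF p(1), of w] supp[OF p'(1), of w] by blast
    qed
    then have "card V \<le> card (\<Union>e\<in>set p \<union> set p'. ends e)"
      by (intro card_mono) (auto simp: ends_def)
    also have "\<dots> \<le> (\<Sum>e\<in>set p \<union> set p'. card (ends e))"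
      by (rule card_UN_le) simp
    also have "\<dots> \<le> (\<Sum>e\<in>set p \<union> set p'. 2)"
      by (intro sum_mono) (auto simp: ends_def card_insert_if)
    also have "\<dots> = 2 * card (set p \<union> set p')" by simp
    also have "\<dots> \<le> 2 * (card (set p) + card (set p'))"
      by (intro mult_left_mono card_Un_le) simp
    also have "\<dots> \<le> 4 * r"
      using card_length[of p] card_length[of p'] p(3) p'(3) by simp
    finally show ?thesis .
  qed
  moreover have "\<beta> \<in> V \<rightarrow> nz"
    using cl by (auto simp: V_def \<beta>_def nz_iff)
  moreover have "(\<Oplus>w\<in>V. \<beta> w \<otimes> f w i) = \<zero>" if i: "i < n" for i
  proof -
    have fi: "(\<lambda>w. f w i) \<in> M \<rightarrow> carrier R" using f_closed i by auto
    have \<beta>: "\<beta> w \<in> carrier R" for w using cl by (simp add: \<beta>_def)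
    have "(\<Oplus>w\<in>V. \<beta> w \<otimes> f w i) = (\<Oplus>w\<in>M. \<beta> w \<otimes> f w i)"
      by (rule add.finprod_mono_neutral_cong_left)
        (use finM fi \<beta> in \<open>auto simp: V_def Pi_iff\<close>)
    also have "\<dots> = (\<Oplus>w\<in>M. coeffs p w \<otimes> f w i \<ominus> coeffs p' w \<otimes> f w i)"
      using fi cl by (intro add.finprod_cong') (auto simp: \<beta>_def a_minus_def l_distr l_minus Pi_iff)
    also have "\<dots> = (\<Oplus>w\<in>M. coeffs p w \<otimes> f w i) \<ominus> (\<Oplus>w\<in>M. coeffs p' w \<otimes> f w i)"
      by (rule finsum_diff) (use fi cl in auto)
    also have "(\<Oplus>w\<in>M. coeffs p w \<otimes> f w i) = (\<Oplus>w\<in>M. coeffs p' w \<otimes> f w i)"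
    proof -
      have "encoded S i \<oplus> (\<Oplus>w\<in>M. coeffs p w \<otimes> f w i) = encoded S i \<oplus> (\<Oplus>w\<in>M. coeffs p' w \<otimes> f w i)"
        using encoded_endpoint[OF p(1,2) S i] encoded_endpoint[OF p'(1,2) S i] assms(7) by simp
      moreover have "(\<Oplus>w\<in>M. coeffs p w \<otimes> f w i) \<in> carrier R" "(\<Oplus>w\<in>M. coeffs p' w \<otimes> f w i) \<in> carrier R"
        using fi cl by (auto intro!: finsum_closed)
      ultimately show ?thesis using encoded_closed[OF S] by simp
    qed
    finally show ?thesis
      using fi cl by (simp add: a_minus_def r_neg Pi_iff)
  qed
  ultimately show ?thesis
    using that[of V \<beta>] by (auto simp: V_def)
qed

end

section \<open>Conflicts in a family with groups of equal size\<close>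

locale kikuchi_regular = kikuchi R n l s s1 M grp base f en
  for R (structure) and n l s s1 :: nat and M :: "'b set" and grp :: "'b \<Rightarrow> 'g" and base f en +
  fixes t :: nat and \<tau> :: "nat \<Rightarrow> nat"
  assumes base: "x \<in> M \<Longrightarrow> base (grp x) \<subseteq> {..<n} \<and> card (base (grp x)) = t"
    and base_nz: "x \<in> M \<Longrightarrow> i \<in> base (grp x) \<Longrightarrow> f x i \<noteq> \<zero>"
    and fibre: "x \<in> M \<Longrightarrow> card {y \<in> M. grp y = grp x} = \<tau> t"
    and codegree: "\<lbrakk>x \<in> M; base (grp x) \<subseteq> J; J \<subseteq> {i. i < n \<and> f x i \<noteq> \<zero>}\<rbrakk>
      \<Longrightarrow> card {y \<in> M. grp y = grp x \<and> (\<forall>i\<in>J. f y i = f x i)} \<le> \<tau> (card J)"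
    and s1: "s1 \<le> s"
    and sparse: "i \<le> s1 \<Longrightarrow> j \<le> s - s1 \<Longrightarrow> l ^ (s - (i + j)) * (\<tau> (t + i) * \<tau> (t + j)) \<le> 9 * (n * card nz) ^ (s - (i + j))"
    and sparse0: "l ^ s * (card nz * \<tau> t) \<le> 9 * (n * card nz) ^ s"
    and \<tau>_pos: "0 < \<tau> j"
begin

abbreviation mem :: "'b \<Rightarrow> 'b set" where
  "mem w \<equiv> {y \<in> M. grp y = grp w}"

text \<open>For a fixed scalar, prescribed cells determine coordinates and values of
  \<open>f\<close>. All members counted therefore agree with one of them on the base and on
  \<open>card Q\<close> further coordinates, and \<open>codegree\<close> applies.\<close>

lemma card_cells:
  assumes "b \<in> nz" "Q \<subseteq> {..<s}"
  shows "card {y \<in> mem w. \<forall>i\<in>Q. cell b y i = \<zeta> i} \<le> \<tau> (t + card Q)"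
proof (cases "{y \<in> mem w. \<forall>i\<in>Q. cell b y i = \<zeta> i} = {}")
  case False
  then obtain x where x: "x \<in> M" "grp x = grp w" "\<And>i. i \<in> Q \<Longrightarrow> cell b x i = \<zeta> i"
    by blast
  define J where "J = base (grp x) \<union> en x ` Q"
  have inj: "inj_on (en x) Q"
    using en[OF x(1)] assms(2) by (auto simp: bij_betw_def intro: inj_on_subset)
  have sub: "en x ` Q \<subseteq> {i. i < n \<and> i \<notin> base (grp x) \<and> f x i \<noteq> \<zero>}"
    using en[OF x(1)] assms(2) by (auto simp: bij_betw_def)
  have "finite Q" using assms(2) finite_subset by blast
  moreover have "finite (base (grp x))" using base[OF x(1)] finite_subset by blast
  ultimately have "card J = t + card Q"
    using base[OF x(1)] sub inj unfolding J_def by (subst card_Un_disjoint) (auto simp: card_image)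
  moreover have "J \<subseteq> {i. i < n \<and> f x i \<noteq> \<zero>}"
    using base[OF x(1)] base_nz[OF x(1)] sub by (auto simp: J_def)
  moreover have "{y \<in> mem w. \<forall>i\<in>Q. cell b y i = \<zeta> i} \<subseteq> {y \<in> M. grp y = grp x \<and> (\<forall>i\<in>J. f y i = f x i)}"
  proof
    fix y assume "y \<in> {y \<in> mem w. \<forall>i\<in>Q. cell b y i = \<zeta> i}"
    then have y: "y \<in> M" "grp y = grp x" and yQ: "\<And>i. i \<in> Q \<Longrightarrow> cell b y i = cell b x i"
      using x by auto
    have "f y j = f x j" if "j \<in> J" for j
      using that unfolding J_def
    proof
      assume "j \<in> base (grp x)"
      then show ?thesis using f_base[OF x(1) y(1)] y(2) by simp
    next
      assume "j \<in> en x ` Q"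
      then obtain i where i: "i \<in> Q" "j = en x i" by blast
      then have "b \<otimes> f y j = b \<otimes> f x j" using yQ[OF i(1)] by (auto simp: cell_def)
      moreover have "j < n" using sub i by auto
      ultimately show ?thesis
        using assms(1) f_closed x(1) y(1) m_lcancel by (simp add: nz_iff)
    qed
    then show "y \<in> {y \<in> M. grp y = grp x \<and> (\<forall>i\<in>J. f y i = f x i)}"
      using y by simp
  qed
  then have "card {y \<in> mem w. \<forall>i\<in>Q. cell b y i = \<zeta> i} \<le> card {y \<in> M. grp y = grp x \<and> (\<forall>i\<in>J. f y i = f x i)}"
    using finM by (intro card_mono) auto
  ultimately show ?thesis
    using codegree[OF x(1), of J] by (force simp: J_def)
next
  case True
  then show ?thesis by (simp only: card.empty)
qed

lemma cell_scalar_unique: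
  assumes "b \<in> nz" "b' \<in> nz" "x \<in> M" "i < s" "cell b x i = cell b' x i"
  shows "b = b'"
  using en_props(3)[OF assms(3,4)] assms m_rcancel by (simp add: cell_def nz_iff)

text \<open>Completions of steps with one end fixed at \<open>w\<close>. For \<open>w\<close> as
  first end the step is \<open>(b, w, y)\<close>. For \<open>w\<close> as second end exchange
  \<open>Q\<close> and \<open>Q'\<close> and take \<open>(\<ominus> b, y, w)\<close>, whose pattern
  has cells of \<open>y\<close> with scalar \<open>\<ominus> b\<close> first and cells of
  \<open>w\<close> with scalar \<open>b\<close> last.\<close>

definition partners :: "'b \<Rightarrow> nat set \<Rightarrow> nat set \<Rightarrow> (nat \<Rightarrow> nat \<times> 'a) \<Rightarrow> ('a \<times> 'b) set" where
  "partners w Q Q' \<zeta> = {(b, y). b \<in> nz \<and> y \<in> mem w \<and> (\<forall>i\<in>Q. cell b w i = \<zeta> i) \<and> (\<forall>i\<in>Q'. cell (\<ominus> b) y i = \<zeta> i)}"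

lemma finite_partners: "finite (partners w Q Q' \<zeta>)"
  by (rule finite_subset[of _ "nz \<times> M"]) (auto simp: partners_def finite_nz finM)

text \<open>One prescribed cell of \<open>w\<close> determines the scalar, which leaves the choice
  of \<open>y\<close>. If only cells of \<open>y\<close> are prescribed, \<open>y\<close> determines
  the scalar. With nothing prescribed the scalar is free, at the price of a factor
  \<open>card nz\<close>.\<close>

lemma card_partners:
  assumes w: "w \<in> M" and Q: "Q \<subseteq> {..<s}" "Q' \<subseteq> {..<s}"
  shows "card (partners w Q Q' \<zeta>)
    \<le> (if Q \<noteq> {} then \<tau> (t + card Q') else if Q' \<noteq> {} then \<tau> t else card nz * \<tau> t)"
proof (cases "Q = {}")
  case False
  then obtain i where i: "i \<in> Q" "i < s" using Q by auto
  show ?thesis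
  proof (cases "partners w Q Q' \<zeta> = {}")
    case ne: False
    then obtain b y where b: "b \<in> nz" "cell b w i = \<zeta> i" using i by (auto simp: partners_def)
    have "partners w Q Q' \<zeta> \<subseteq> Pair b ` {y \<in> mem w. \<forall>i\<in>Q'. cell (\<ominus> b) y i = \<zeta> i}"
    proof
      fix e assume "e \<in> partners w Q Q' \<zeta>"
      then obtain b' y where e: "e = (b', y)" "b' \<in> nz" "y \<in> mem w" "cell b' w i = \<zeta> i"
        "\<forall>i\<in>Q'. cell (\<ominus> b') y i = \<zeta> i"
        using i by (auto simp: partners_def)
      then have "b' = b" using cell_scalar_unique[OF _ b(1) w i(2), of b'] b(2) by simp
      then show "e \<in> Pair b ` {y \<in> mem w. \<forall>i\<in>Q'. cell (\<ominus> b) y i = \<zeta> i}" using e by auto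
    qed
    then have "card (partners w Q Q' \<zeta>) \<le> card {y \<in> mem w. \<forall>i\<in>Q'. cell (\<ominus> b) y i = \<zeta> i}"
      using finM by (intro surj_card_le) auto
    also have "\<dots> \<le> \<tau> (t + card Q')"
      by (rule card_cells[OF nz_minus[OF b(1)] Q(2)])
    finally show ?thesis using False by simp
  qed simp
next
  case Qe: True
  show ?thesis
  proof (cases "Q' = {}")
    case False
    then obtain i where i: "i \<in> Q'" "i < s" using Q by auto
    have "inj_on snd (partners w Q Q' \<zeta>)"
    proof (rule inj_onI)
      fix d e assume "d \<in> partners w Q Q' \<zeta>" "e \<in> partners w Q Q' \<zeta>" "snd d = snd e"
      then obtain b b' y where de: "d = (b, y)" "e = (b', y)" "b \<in> nz" "b' \<in> nz" "y \<in> M"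
        "cell (\<ominus> b) y i = cell (\<ominus> b') y i"
        using i by (auto simp: partners_def)
      then have "\<ominus> b = \<ominus> b'"
        using cell_scalar_unique[OF nz_minus nz_minus _ i(2)] by blast
      then have "b = b'" using de by (metis minus_minus nz_iff)
      then show "d = e" using de by simp
    qed
    then have "card (partners w Q Q' \<zeta>) = card (snd ` partners w Q Q' \<zeta>)"
      by (simp add: card_image)
    also have "\<dots> \<le> card (mem w)"
      using finM by (intro card_mono) (auto simp: partners_def)
    finally show ?thesis using fibre[OF w] Qe False by simp
  next
    case True
    have "card (partners w Q Q' \<zeta>) \<le> card (nz \<times> mem w)"
      using finM finite_nz by (intro card_mono) (auto simp: partners_def)
    then show ?thesis using fibre[OF w] Qe True by (simp add: card_cartesian_product)
  qed
qed

text \<open>Fixing one end leaves at most as many choices as the product in \<open>sparse\<close>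
  allows, since all values of \<open>\<tau>\<close> are at least 1. Only a free scalar escapes this
  bound, and \<open>sparse0\<close> covers it.\<close>

lemma partners_sparse:
  assumes w: "w \<in> M" and Q: "Q \<subseteq> {..<s1}" "Q' \<subseteq> {s1..<s}"
  shows "l ^ (s - (card Q + card Q')) * card (partners w Q Q' \<zeta>) \<le> 9 * (n * card nz) ^ (s - (card Q + card Q'))"
    and "l ^ (s - (card Q + card Q')) * card (partners w Q' Q \<zeta>) \<le> 9 * (n * card nz) ^ (s - (card Q + card Q'))"
proof -
  have Qs: "Q \<subseteq> {..<s}" "Q' \<subseteq> {..<s}" using Q s1 by auto
  have cQ: "card Q \<le> s1" "card Q' \<le> s - s1"
    using card_mono[OF _ Q(1)] card_mono[OF _ Q(2)] by auto
  have fQ: "finite Q" "finite Q'" using Q finite_subset by blast+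
  note sp = sparse[OF cQ]
  have le: "\<tau> (t + card Q) \<le> \<tau> (t + card Q) * \<tau> (t + card Q')" "\<tau> (t + card Q') \<le> \<tau> (t + card Q) * \<tau> (t + card Q')"
    using mult_le_mono[of "\<tau> (t + card Q)" "\<tau> (t + card Q)" 1 "\<tau> (t + card Q')"]
      mult_le_mono[of 1 "\<tau> (t + card Q)" "\<tau> (t + card Q')" "\<tau> (t + card Q')"]
      \<tau>_pos[of "t + card Q"] \<tau>_pos[of "t + card Q'"] by simp_all
  let ?L = "l ^ (s - (card Q + card Q'))"
  have aux: "?L * c \<le> 9 * (n * card nz) ^ (s - (card Q + card Q'))"
    if "c \<le> \<tau> (t + card Q) \<or> c \<le> \<tau> (t + card Q') \<or> Q = {} \<and> Q' = {} \<and> c \<le> card nz * \<tau> t" for c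
    using that
  proof (elim disjE conjE)
    assume "c \<le> \<tau> (t + card Q)"
    then have "?L * c \<le> ?L * (\<tau> (t + card Q) * \<tau> (t + card Q'))"
      by (intro mult_left_mono order_trans[OF _ le(1)]) auto
    then show ?thesis using sp by linarith
  next
    assume "c \<le> \<tau> (t + card Q')"
    then have "?L * c \<le> ?L * (\<tau> (t + card Q) * \<tau> (t + card Q'))"
      by (intro mult_left_mono order_trans[OF _ le(2)]) auto
    then show ?thesis using sp by linarith
  next
    assume *: "Q = {}" "Q' = {}" "c \<le> card nz * \<tau> t"
    have "l ^ s * c \<le> l ^ s * (card nz * \<tau> t)"
      by (rule mult_left_mono[OF *(3)]) simp
    also note sparse0
    finally show ?thesis using *(1,2) by simp
  qed
  show "?L * card (partners w Q Q' \<zeta>) \<le> 9 * (n * card nz) ^ (s - (card Q + card Q'))"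
    using card_partners[OF w Qs, of \<zeta>] fQ by (intro aux) (auto split: if_splits)
  show "?L * card (partners w Q' Q \<zeta>) \<le> 9 * (n * card nz) ^ (s - (card Q + card Q'))"
    using card_partners[OF w Qs(2) Qs(1), of \<zeta>] fQ by (intro aux) (auto split: if_splits)
qed

text \<open>Two steps in conflict either use the same group and, up to sign, the same scalar, or they
  share one of their vectors.\<close>

lemma conflicts_sparse:
  assumes a: "a \<in> steps" and I: "I \<subseteq> {..<s}"
  shows "l ^ (s - card I) * card {a' \<in> steps. colours a' \<inter> colours a \<noteq> {} \<and> (\<forall>i\<in>I. pattern a' i = pattern a i)}
    \<le> 54 * card ({..<n} \<times> nz) ^ (s - card I)"
proof -
  obtain c x y where a_eq: "a = (c, x, y)" by (metis prod.exhaust)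
  have c: "c \<in> nz" and xy: "x \<in> M" "y \<in> M" "grp x = grp y" using a by (auto simp: a_eq steps_iff)
  define Q where "Q = I \<inter> {..<s1}"
  define Q' where "Q' = I \<inter> {s1..<s}"
  have QQ: "I = Q \<union> Q'" "Q \<inter> Q' = {}" "Q \<subseteq> {..<s1}" "Q' \<subseteq> {s1..<s}"
    using I by (auto simp: Q_def Q'_def)
  have fin: "finite Q" "finite Q'" using QQ(3,4) finite_subset by blast+
  have cI: "card I = card Q + card Q'" using QQ(1,2) fin by (simp add: card_Un_disjoint)
  have cQ: "card Q \<le> s1" "card Q' \<le> s - s1"
    using card_mono[OF _ QQ(3)] card_mono[OF _ QQ(4)] by auto
  have Qs: "Q \<subseteq> {..<s}" "Q' \<subseteq> {..<s}" using QQ(3,4) s1 by auto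
  define \<zeta> where "\<zeta> = pattern a"
  have match: "(\<forall>i\<in>I. pattern (c', x', y') i = pattern a i) \<longleftrightarrow>
      (\<forall>i\<in>Q. cell c' x' i = \<zeta> i) \<and> (\<forall>i\<in>Q'. cell (\<ominus> c') y' i = \<zeta> i)" for c' x' y'
    using QQ by (auto simp: \<zeta>_def pattern_def)
  \<comment> \<open>With the same group and a given scalar \<open>b\<close> the two ends are chosen
    independently, which yields the product of codegrees in \<open>sparse\<close>.\<close>
  define P1 where "P1 = (\<lambda>b. {x' \<in> mem x. \<forall>i\<in>Q. cell b x' i = \<zeta> i} \<times> {y' \<in> mem x. \<forall>i\<in>Q'. cell (\<ominus> b) y' i = \<zeta> i})"
  let ?T = "{a' \<in> steps. colours a' \<inter> colours a \<noteq> {} \<and> (\<forall>i\<in>I. pattern a' i = pattern a i)}"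
  let ?swap = "\<lambda>w (b, v). (\<ominus> b, v, w)"
  let ?keep = "\<lambda>w (b, v). (b, w, v)"
  \<comment> \<open>Six classes: the same group with scalar \<open>c\<close> or
    \<open>\<ominus> c\<close>, and \<open>x\<close> or \<open>y\<close> as the first or as the
    second vector of \<open>a'\<close>. Each obeys the bound with constant 9, which gives
    54.\<close>
  let ?U = "((Pair c ` P1 c) \<union> (Pair (\<ominus> c) ` P1 (\<ominus> c))) \<union>
     ((?keep x ` partners x Q Q' \<zeta> \<union> ?keep y ` partners y Q Q' \<zeta>) \<union>
     (?swap x ` partners x Q' Q \<zeta> \<union> ?swap y ` partners y Q' Q \<zeta>))"
  have "?T \<subseteq> ?U"
  proof
    fix a' assume a': "a' \<in> ?T"
    obtain c' x' y' where eq: "a' = (c', x', y')" by (metis prod.exhaust)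
    have st: "c' \<in> nz" "x' \<in> M" "y' \<in> M" "grp x' = grp y'"
      and m: "\<forall>i\<in>Q. cell c' x' i = \<zeta> i" "\<forall>i\<in>Q'. cell (\<ominus> c') y' i = \<zeta> i"
      using a' match[of c' x' y'] by (auto simp: eq steps_iff)
    have cc: "\<ominus> (\<ominus> c') = c'" using st(1) by (simp add: nz_iff)
    have "{c', \<ominus> c'} = {c, \<ominus> c} \<and> grp x' = grp x \<or> x' \<in> {x, y} \<or> y' \<in> {x, y}"
      using a' by (auto simp: eq a_eq colours_def)
    then consider "c' \<in> {c, \<ominus> c}" "grp x' = grp x" | w where "w \<in> {x, y}" "x' = w" | w where "w \<in> {x, y}" "y' = w"
      by blast
    then show "a' \<in> ?U"
    proof cases
      case 1
      then have "(x', y') \<in> P1 c'" using st m by (auto simp: P1_def)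
      then show ?thesis using 1 by (auto simp: eq)
    next
      case 2
      then have "(c', y') \<in> partners w Q Q' \<zeta>" using st m by (auto simp: partners_def)
      then have "a' \<in> ?keep w ` partners w Q Q' \<zeta>" using 2 by (force simp: eq)
      then show ?thesis using 2 by blast
    next
      case 3
      then have "(\<ominus> c', x') \<in> partners w Q' Q \<zeta>" using st m cc nz_minus by (auto simp: partners_def)
      then have "a' \<in> ?swap w ` partners w Q' Q \<zeta>" using 3 cc by (force simp: eq)
      then show ?thesis using 3 by blast
    qed
  qed
  have finP: "finite (P1 b)" for b using finM by (simp add: P1_def)
  have "card ?T \<le> card ?U"
    by (rule card_mono[OF _ \<open>?T \<subseteq> ?U\<close>]) (use finP finite_partners in auto)
  also have "\<dots> \<le> (card (P1 c) + card (P1 (\<ominus> c))) +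
     ((card (partners x Q Q' \<zeta>) + card (partners y Q Q' \<zeta>)) + (card (partners x Q' Q \<zeta>) + card (partners y Q' Q \<zeta>)))"
    by (intro order_trans[OF card_Un_le] add_mono card_image_le finP finite_partners)
  finally have T: "card ?T \<le> \<dots>" .
  let ?L = "l ^ (s - (card Q + card Q'))" and ?B = "9 * (n * card nz) ^ (s - (card Q + card Q'))"
  have P: "?L * card (P1 b) \<le> ?B" if "b \<in> nz" for b
  proof -
    have "card (P1 b) \<le> \<tau> (t + card Q) * \<tau> (t + card Q')"
      unfolding P1_def card_cartesian_product
      by (intro mult_mono card_cells that nz_minus Qs) auto
    then have "?L * card (P1 b) \<le> ?L * (\<tau> (t + card Q) * \<tau> (t + card Q'))"
      by (rule mult_left_mono) simp
    then show ?thesis using sparse[OF cQ] by linarith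
  qed
  have "?L * card ?T \<le> ?L * ((card (P1 c) + card (P1 (\<ominus> c))) +
     ((card (partners x Q Q' \<zeta>) + card (partners y Q Q' \<zeta>)) + (card (partners x Q' Q \<zeta>) + card (partners y Q' Q \<zeta>))))"
    by (rule mult_left_mono[OF T]) simp
  also have "\<dots> \<le> (?B + ?B) + ((?B + ?B) + (?B + ?B))"
    unfolding distrib_left
    by (intro add_mono P c nz_minus partners_sparse xy QQ)
  finally show ?thesis
    by (simp add: cI card_cartesian_product)
qed

lemma card_steps: "card steps = card nz * card M * (\<tau> t - 1)"
proof -
  have "steps = nz \<times> (SIGMA x:M. mem x - {x})"
    by (auto simp: steps_def)
  then have "card steps = card nz * (\<Sum>x\<in>M. card (mem x - {x}))"
    using finM by (simp add: card_cartesian_product card_SigmaI)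
  also have "(\<Sum>x\<in>M. card (mem x - {x})) = (\<Sum>x\<in>M. \<tau> t - 1)"
    using fibre finM by (intro sum.cong) auto
  finally show ?thesis by simp
qed

theorem dependency:
  assumes "0 < n" "0 < l"
    and large: "4 * (d + 3 * r * (4 * (2 ^ s * 54))) * (n * card nz) ^ s < card nz * card M * (\<tau> t - 1) * l ^ s"
    and d: "(n * card nz) ^ (s * l) * (r * (4 * (2 ^ s * 54))) ^ r < d ^ r"
  obtains V \<beta> where "V \<noteq> {}" "V \<subseteq> M" "card V \<le> 4 * r" "\<beta> \<in> V \<rightarrow> nz"
    "\<And>i. i < n \<Longrightarrow> (\<Oplus>w\<in>V. \<beta> w \<otimes> f w i) = \<zero>"
proof -
  have ne: "{..<n} \<times> nz \<noteq> {}"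
    using \<open>0 < n\<close> nz_iff[of \<one>] by auto
  have card: "card ({..<n} \<times> nz) = n * card nz"
    by (simp add: card_cartesian_product)
  have col: "finite (colours a) \<and> card (colours a) \<le> 3" for a
    by (auto simp: colours_def card_insert_if split: prod.split)
  have key: "label a \<in> colours a" for a
    by (auto simp: colours_def label_def split: prod.split)
  obtain S p p' where "set p \<subseteq> arcs" "set p' \<subseteq> arcs" "length p = r" "length p' = r"
    "rainbow S {} p" "rainbow S {} p'" "endpoint S p = endpoint S p'"
    "(\<lambda>(S, u). label (fst u)) ` set p \<noteq> (\<lambda>(S, u). label (fst u)) ` set p'"
    by (rule two_walks[OF ne \<open>0 < l\<close> col key conflicts_sparse, of d r])
      (use large d in \<open>simp_all only: card card_steps\<close>)
  then show ?thesis
    using dependency_of_walks[of p S r p'] that by blast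
qed

end

section \<open>Decomposition into groups\<close>

definition small_dependency :: "('a, 'm) ring_scheme \<Rightarrow> nat \<Rightarrow> (nat \<Rightarrow> 'a) set \<Rightarrow> real \<Rightarrow> bool" where
  "small_dependency F n H b \<longleftrightarrow> (\<exists>V \<alpha>. V \<noteq> {} \<and> V \<subseteq> H \<and> real (card V) \<le> b \<and>
     (\<forall>v\<in>V. \<alpha> v \<in> nonzero_elems F) \<and> lin_comb F n \<alpha> V = zero_vector F n)"

lemma small_dependencyI:
  assumes "V \<noteq> {}" "V \<subseteq> H" "real (card V) \<le> b" "\<And>v. v \<in> V \<Longrightarrow> \<alpha> v \<in> nonzero_elems F"
    "\<And>i. i < n \<Longrightarrow> (\<Oplus>\<^bsub>F\<^esub>v\<in>V. \<alpha> v \<otimes>\<^bsub>F\<^esub> v i) = \<zero>\<^bsub>F\<^esub>"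
  shows "small_dependency F n H b"
proof -
  have "lin_comb F n \<alpha> V = zero_vector F n"
    using assms(5) by (auto simp: lin_comb_def zero_vector_def)
  then show ?thesis
    using assms unfolding small_dependency_def by blast
qed

lemma small_dependency_mono:
  assumes "small_dependency F n H b" "H \<subseteq> H'" "b \<le> b'"
  shows "small_dependency F n H' b'"
proof -
  obtain V \<alpha> where "V \<noteq> {}" "V \<subseteq> H" "real (card V) \<le> b"
    "\<forall>v\<in>V. \<alpha> v \<in> nonzero_elems F" "lin_comb F n \<alpha> V = zero_vector F n"
    using assms(1) unfolding small_dependency_def by blast
  moreover have "V \<subseteq> H'" "real (card V) \<le> b'" using calculation assms(2,3) by auto
  ultimately show ?thesis unfolding small_dependency_def by blast
qed

section \<open>Elementary dependencies\<close>

context field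
begin

lemma coord_closed: "v \<in> coord_space R n \<Longrightarrow> i < n \<Longrightarrow> v i \<in> carrier R"
  by (auto simp: coord_space_def)

lemma finite_coord_space: "finite (carrier R) \<Longrightarrow> finite (coord_space R n)"
  by (simp add: coord_space_def finite_PiE)

text \<open>Two of the coefficient tuples have the same linear combination.\<close>

lemma many_vectors_dependent:
  assumes fin: "finite (carrier R)" and W: "W \<subseteq> coord_space R n" "finite W" "n < card W"
  shows "small_dependency R n W (card W)"
proof -
  let ?q = "card (carrier R)"
  have sub: "{\<zero>, \<one>} \<subseteq> carrier R" by auto
  have q: "1 < ?q"
    using card_mono[OF fin sub] by simp
  define L where "L = (\<lambda>\<beta>. lin_comb R n \<beta> W)"
  have fi: "(\<lambda>w. w i) \<in> W \<rightarrow> carrier R" if "i < n" for i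
    using W(1) coord_closed that by blast
  have L_in: "L ` (W \<rightarrow>\<^sub>E carrier R) \<subseteq> coord_space R n"
  proof
    fix y assume "y \<in> L ` (W \<rightarrow>\<^sub>E carrier R)"
    then obtain \<beta> where "\<beta> \<in> W \<rightarrow> carrier R" "y = L \<beta>" by (auto simp: PiE_iff)
    then show "y \<in> coord_space R n"
      using fi unfolding L_def lin_comb_def coord_space_def
      by (auto simp: restrict_PiE_iff Pi_iff simp del: restrict_PiE intro!: finsum_closed)
  qed
  have "card (L ` (W \<rightarrow>\<^sub>E carrier R)) \<le> card (coord_space R n)"
    by (rule card_mono[OF finite_coord_space[OF fin] L_in])
  also have "\<dots> = ?q ^ n"
    by (simp add: coord_space_def card_PiE)
  also have "\<dots> < ?q ^ card W"
    using q W(3) by (rule power_strict_increasing[rotated])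
  also have "\<dots> = card (W \<rightarrow>\<^sub>E carrier R)"
    using W(2) by (simp add: card_PiE)
  finally have "\<not> inj_on L (W \<rightarrow>\<^sub>E carrier R)"
    by (rule pigeonhole)
  then obtain \<beta> \<beta>' where \<beta>: "\<beta> \<in> W \<rightarrow>\<^sub>E carrier R" "\<beta>' \<in> W \<rightarrow>\<^sub>E carrier R" "L \<beta> = L \<beta>'" "\<beta> \<noteq> \<beta>'"
    by (auto simp: inj_on_def)
  have cl: "\<beta> w \<in> carrier R" "\<beta>' w \<in> carrier R" if "w \<in> W" for w
    using \<beta>(1,2) that by (auto simp: PiE_iff)
  define \<gamma> where "\<gamma> = (\<lambda>w. \<beta> w \<ominus> \<beta>' w)"
  define V where "V = {w \<in> W. \<gamma> w \<noteq> \<zero>}"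
  obtain w where w: "w \<in> W" "\<beta> w \<noteq> \<beta>' w"
    using \<beta> by (metis PiE_ext)
  then have "w \<in> V"
    using cl[OF w(1)] add_eq_iff_eq_minus[OF zero_closed cl(2)[OF w(1)] cl(1)[OF w(1)]]
    by (simp add: V_def \<gamma>_def)
  show ?thesis
  proof (rule small_dependencyI)
    show "V \<noteq> {}" using \<open>w \<in> V\<close> by blast
    show "V \<subseteq> W" by (auto simp: V_def)
    then show "real (card V) \<le> real (card W)"
      using W(2) by (simp add: card_mono)
    show "\<gamma> v \<in> nonzero_elems R" if "v \<in> V" for v
      using that cl by (auto simp: V_def \<gamma>_def nonzero_elems_def)
    fix i assume i: "i < n"
    have 1: "(\<lambda>w. \<beta> w \<otimes> w i) \<in> W \<rightarrow> carrier R" "(\<lambda>w. \<beta>' w \<otimes> w i) \<in> W \<rightarrow> carrier R"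
      using fi[OF i] cl by (auto simp: Pi_iff)
    have eq: "(\<Oplus>w\<in>W. \<beta> w \<otimes> w i) = (\<Oplus>w\<in>W. \<beta>' w \<otimes> w i)"
      using fun_cong[OF \<beta>(3), of i] i by (simp add: L_def lin_comb_def)
    have "(\<Oplus>v\<in>V. \<gamma> v \<otimes> v i) = (\<Oplus>v\<in>W. \<gamma> v \<otimes> v i)"
      by (rule add.finprod_mono_neutral_cong_left)
        (use W(2) fi[OF i] cl in \<open>auto simp: V_def \<gamma>_def Pi_iff\<close>)
    also have "\<dots> = (\<Oplus>w\<in>W. \<beta> w \<otimes> w i \<ominus> \<beta>' w \<otimes> w i)"
      using fi[OF i] cl by (intro add.finprod_cong') (auto simp: \<gamma>_def a_minus_def l_distr l_minus Pi_iff)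
    also have "\<dots> = \<zero>"
      using finsum_diff[OF 1] finsum_closed[OF 1(2)] eq by (simp add: a_minus_def r_neg)
    finally show "(\<Oplus>v\<in>V. \<gamma> v \<otimes> v i) = \<zero>" .
  qed
qed

text \<open>Proportionality replaces equality because a dependency may rescale each vector. At a
  single coordinate any two nonzero entries are proportional, so degrees carry no factor depending
  on the field.\<close>

definition prop_on :: "nat set \<Rightarrow> (nat \<Rightarrow> 'a) \<Rightarrow> (nat \<Rightarrow> 'a) \<Rightarrow> bool" where
  "prop_on J v w \<longleftrightarrow> (\<exists>c\<in>nonzero_elems R. \<forall>i\<in>J. w i = c \<otimes> v i)"

lemma proportional_dependent:
  assumes "v \<in> coord_space R n" "w \<in> coord_space R n" "v \<noteq> w" "prop_on {..<n} v w"
  shows "small_dependency R n {v, w} 2"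
proof -
  obtain c where c: "c \<in> nonzero_elems R" "\<And>i. i < n \<Longrightarrow> w i = c \<otimes> v i"
    using assms(4) by (auto simp: prop_on_def)
  then have c': "c \<in> carrier R" by (simp add: nonzero_elems_def)
  have "\<ominus> \<one> \<noteq> \<zero>" using one_not_zero by (metis minus_minus minus_zero one_closed)
  then have m: "\<ominus> \<one> \<in> nonzero_elems R" by (simp add: nonzero_elems_def)
  show ?thesis
  proof (rule small_dependencyI[where V = "{v, w}" and \<alpha> = "\<lambda>u. if u = v then c else \<ominus> \<one>"])
    fix i assume i: "i < n"
    have "v i \<in> carrier R" "w i \<in> carrier R" using assms(1,2) coord_closed i by auto
    then show "(\<Oplus>u\<in>{v, w}. (if u = v then c else \<ominus> \<one>) \<otimes> u i) = \<zero>"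
      using assms(3) c' c(2)[OF i] by (auto simp: l_minus r_neg)
  qed (use c m assms(3) in auto)
qed

section \<open>Packing vectors by proportional coordinates\<close>

abbreviation supp :: "nat \<Rightarrow> (nat \<Rightarrow> 'a) \<Rightarrow> nat set" where
  "supp n v \<equiv> {i \<in> {..<n}. v i \<noteq> \<zero>}"

definition petals :: "nat \<Rightarrow> nat \<Rightarrow> (nat \<Rightarrow> 'a) set \<Rightarrow> bool" where
  "petals n t G \<longleftrightarrow> (\<exists>J v. v \<in> coord_space R n \<and> J \<subseteq> supp n v \<and> card J = t \<and> (\<forall>w\<in>G. prop_on J v w))"

text \<open>A maximal disjoint family leaves no room: \<open>T\<close> leftover vectors proportional
  to \<open>v\<close> on \<open>J\<close> would form another group. This group is nonempty as
  \<open>0 < T\<close>, so it cannot already be in the family.\<close>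

lemma petal_packing:
  assumes "finite A" "A \<subseteq> coord_space R n" "0 < T"
  obtains \<P> where "pairwise disjnt \<P>" "\<And>G. G \<in> \<P> \<Longrightarrow> G \<subseteq> A \<and> card G = T \<and> petals n t G"
    "\<And>v J. v \<in> A - \<Union>\<P> \<Longrightarrow> J \<subseteq> supp n v \<Longrightarrow> card J = t \<Longrightarrow> card {w \<in> A - \<Union>\<P>. prop_on J v w} < T"
proof -
  define Fam where "Fam = {\<P>. pairwise disjnt \<P> \<and> (\<forall>G\<in>\<P>. G \<subseteq> A \<and> card G = T \<and> petals n t G)}"
  have "finite Fam"
    by (rule finite_subset[of _ "Pow (Pow A)"]) (use assms(1) in \<open>auto simp: Fam_def\<close>)
  moreover have "{} \<in> Fam" by (simp add: Fam_def)
  ultimately obtain \<P> where P: "\<P> \<in> Fam" and maxP: "\<And>\<Q>. \<Q> \<in> Fam \<Longrightarrow> \<P> \<subseteq> \<Q> \<Longrightarrow> \<P> = \<Q>"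
    using finite_has_maximal[of Fam] by blast
  have "card {w \<in> A - \<Union>\<P>. prop_on J v w} < T"
    if v: "v \<in> A - \<Union>\<P>" "J \<subseteq> supp n v" "card J = t" for v J
  proof (rule ccontr)
    assume "\<not> ?thesis"
    then have "T \<le> card {w \<in> A - \<Union>\<P>. prop_on J v w}" by simp
    then obtain G where G: "G \<subseteq> {w \<in> A - \<Union>\<P>. prop_on J v w}" "card G = T"
      by (rule obtain_subset_with_card_n)
    have "petals n t G"
      using G(1) v assms(2) by (auto simp: petals_def intro!: exI[of _ J] exI[of _ v])
    moreover have "disjnt G G'" if "G' \<in> \<P>" for G'
      using G(1) that by (auto simp: disjnt_def)
    ultimately have "insert G \<P> \<in> Fam"
      using P G by (auto simp: Fam_def pairwise_insert disjnt_sym)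
    then have "G \<in> \<P>" using maxP by blast
    then have "G = {}" using G(1) by auto
    then show False using G(2) assms(3) by simp
  qed
  moreover have "pairwise disjnt \<P>" "\<And>G. G \<in> \<P> \<Longrightarrow> G \<subseteq> A \<and> card G = T \<and> petals n t G"
    using P unfolding Fam_def by blast+
  ultimately show ?thesis by (rule that[rotated 2])
qed

text \<open>The invariant of the decomposition: after the stage for \<open>t + 1\<close>, codegrees
  are controlled on all sets of more than \<open>t\<close> coordinates. A packing made in the next
  stage inherits it as a subset.\<close>

definition bounded_above :: "nat \<Rightarrow> (nat \<Rightarrow> nat) \<Rightarrow> nat \<Rightarrow> (nat \<Rightarrow> 'a) set \<Rightarrow> bool" where
  "bounded_above n \<tau> t A \<longleftrightarrow> (\<forall>v\<in>A. \<forall>J\<subseteq>supp n v. t < card J \<longrightarrow> card {w \<in> A. prop_on J v w} \<le> \<tau> (card J))"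

lemma bounded_above_subset:
  assumes "bounded_above n \<tau> t A" "B \<subseteq> A" "finite A"
  shows "bounded_above n \<tau> t B"
  unfolding bounded_above_def
proof (intro ballI allI impI)
  fix v J assume "v \<in> B" "J \<subseteq> supp n v" "t < card J"
  then have "card {w \<in> A. prop_on J v w} \<le> \<tau> (card J)"
    using assms(1,2) by (auto simp: bounded_above_def)
  moreover have "card {w \<in> B. prop_on J v w} \<le> card {w \<in> A. prop_on J v w}"
    using assms(2,3) by (intro card_mono) auto
  ultimately show "card {w \<in> B. prop_on J v w} \<le> \<tau> (card J)" by linarith
qed

text \<open>Double counting of nonzero entries: any two vectors nonzero at \<open>i\<close> are
  proportional on \<open>{i}\<close>, so the bound for singletons limits the number of nonzero
  entries at each coordinate to \<open>\<tau> 1\<close>.\<close>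

lemma bounded_above_0_card:
  assumes A: "finite A" "\<And>v. v \<in> A \<Longrightarrow> sparse_vector R n k v" and "bounded_above n \<tau> 0 A"
  shows "k * card A \<le> n * \<tau> 1"
proof -
  have col: "card {v \<in> A. v i \<noteq> \<zero>} \<le> \<tau> 1" if i: "i < n" for i
  proof (cases "{v \<in> A. v i \<noteq> \<zero>} = {}")
    case False
    then obtain v where v: "v \<in> A" "v i \<noteq> \<zero>" by blast
    have vi: "w i \<in> carrier R" if "w \<in> A" for w
      using A(2)[OF that] i coord_closed by (auto simp: sparse_vector_def)
    have "{w \<in> A. w i \<noteq> \<zero>} \<subseteq> {w \<in> A. prop_on {i} v w}"
    proof
      fix w assume "w \<in> {w \<in> A. w i \<noteq> \<zero>}"
      then have w: "w \<in> A" "w i \<noteq> \<zero>" by auto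
      have u: "v i \<in> Units R" using v vi by (simp add: field_Units)
      have "w i = (w i \<otimes> inv (v i)) \<otimes> v i"
        using u vi[OF w(1)] vi[OF v(1)] by (simp add: m_assoc)
      moreover have "w i \<otimes> inv (v i) \<noteq> \<zero>"
        using calculation w(2) vi[OF v(1)] by (metis l_null)
      then have "w i \<otimes> inv (v i) \<in> nonzero_elems R"
        using u vi[OF w(1)] by (simp add: nonzero_elems_def)
      ultimately show "w \<in> {w \<in> A. prop_on {i} v w}"
        using w(1) by (auto simp: prop_on_def)
    qed
    then have "card {w \<in> A. w i \<noteq> \<zero>} \<le> card {w \<in> A. prop_on {i} v w}"
      using A(1) by (intro card_mono) auto
    also have "\<dots> \<le> \<tau> (card {i})"
    proof -
      have "{i} \<subseteq> supp n v" "0 < card {i}" using v i by auto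
      then show ?thesis using assms(3) v(1) unfolding bounded_above_def by blast
    qed
    finally show ?thesis by simp
  next
    case True
    then show ?thesis by (simp only: card.empty)
  qed
  have "k * card A = (\<Sum>v\<in>A. card (supp n v))"
    using A(2) by (simp add: sparse_vector_def)
  also have "\<dots> = (\<Sum>v\<in>A. \<Sum>i<n. of_bool (v i \<noteq> \<zero>))"
    by (intro sum.cong refl) (simp add: of_bool_def sum.If_cases Collect_conj_eq lessThan_def flip: card_eq_sum)
  also have "\<dots> = (\<Sum>i<n. \<Sum>v\<in>A. of_bool (v i \<noteq> \<zero>))"
    by (rule sum.swap)
  also have "\<dots> = (\<Sum>i<n. card {v \<in> A. v i \<noteq> \<zero>})"
    using A(1) by (intro sum.cong refl) (simp add: of_bool_def sum.If_cases Collect_conj_eq flip: card_eq_sum)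
  also have "\<dots> \<le> (\<Sum>i<n. \<tau> 1)"
    by (intro sum_mono col) simp
  finally show ?thesis by simp
qed

text \<open>Greedy decomposition: for \<open>t = k - 1, k - 2, \<dots>, 1\<close> remove a maximal packing by groups of
  \<open>\<tau> t\<close> vectors that are proportional on \<open>t\<close> common coordinates. If every packing were small, the
  vectors surviving the last stage would have small degrees, and hence be few.\<close>

lemma petal_decomposition:
  assumes H: "finite H" "\<And>v. v \<in> H \<Longrightarrow> sparse_vector R n k v" and k: "1 \<le> k"
    and nonprop: "\<And>v w. v \<in> H \<Longrightarrow> w \<in> H \<Longrightarrow> prop_on {..<n} v w \<Longrightarrow> v = w"
    and \<tau>: "\<And>j. 0 < \<tau> j" and large: "real k * \<theta> + real (n * \<tau> 1) < real (card H)" and \<theta>: "0 \<le> \<theta>"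
  obtains t \<P> where "1 \<le> t" "t < k" "pairwise disjnt \<P>" "\<theta> \<le> real (card (\<Union>\<P>))"
    "\<And>G. G \<in> \<P> \<Longrightarrow> G \<subseteq> H \<and> card G = \<tau> t \<and> petals n t G" "bounded_above n \<tau> t (\<Union>\<P>)"
proof (rule ccontr)
  note hyp = that
  assume neg: "\<not> thesis"
  have stage: "\<exists>B\<subseteq>A. bounded_above n \<tau> (t - 1) B \<and> real (card A) \<le> real (card B) + \<theta>"
    if A: "A \<subseteq> H" "bounded_above n \<tau> t A" and t: "1 \<le> t" "t < k" for A t
  proof -
    have finA: "finite A" using A(1) H(1) finite_subset by blast
    have A': "A \<subseteq> coord_space R n" using A(1) H(2) by (auto simp: sparse_vector_def)
    obtain \<P> where P: "pairwise disjnt \<P>"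
      "\<And>G. G \<in> \<P> \<Longrightarrow> G \<subseteq> A \<and> card G = \<tau> t \<and> petals n t G"
      "\<And>v J. v \<in> A - \<Union>\<P> \<Longrightarrow> J \<subseteq> supp n v \<Longrightarrow> card J = t \<Longrightarrow> card {w \<in> A - \<Union>\<P>. prop_on J v w} < \<tau> t"
      by (rule petal_packing[OF finA A' \<tau>[of t], of t]) (rule that, assumption, simp_all)
    have sub: "\<Union>\<P> \<subseteq> A" using P(2) by blast
    have "real (card (\<Union>\<P>)) < \<theta>"
    proof (rule ccontr)
      assume "\<not> ?thesis"
      then have \<theta>P: "\<theta> \<le> real (card (\<Union>\<P>))" by simp
      have GH: "G \<subseteq> H \<and> card G = \<tau> t \<and> petals n t G" if "G \<in> \<P>" for G
        using P(2)[OF that] A(1) by blast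
      have "thesis"
        by (rule hyp[OF t P(1) \<theta>P GH bounded_above_subset[OF A(2) sub finA]])
      then show False using neg by blast
    qed
    moreover have "card A = card (A - \<Union>\<P>) + card (\<Union>\<P>)"
      using sub finA by (metis card_Diff_subset card_mono finite_subset le_add_diff_inverse2)
    moreover have "bounded_above n \<tau> (t - 1) (A - \<Union>\<P>)"
      unfolding bounded_above_def
    proof (intro ballI allI impI)
      fix v J assume v: "v \<in> A - \<Union>\<P>" "J \<subseteq> supp n v" "t - 1 < card J"
      show "card {w \<in> A - \<Union>\<P>. prop_on J v w} \<le> \<tau> (card J)"
      proof (cases "card J = t")
        case True
        then show ?thesis using P(3)[OF v(1,2)] by simp
      next
        case False
        then show ?thesis
          using bounded_above_subset[OF A(2) _ finA, of "A - \<Union>\<P>"] v t by (auto simp: bounded_above_def)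
      qed
    qed
    ultimately show ?thesis by (intro exI[of _ "A - \<Union>\<P>"]) auto
  qed
  \<comment> \<open>The stages can start at \<open>k - 1\<close> since only
    \<open>J = supp n v\<close> has more than \<open>k - 1\<close> elements. A vector proportional
    to \<open>v\<close> there has the same support, both being of size \<open>k\<close>, so it is
    proportional to \<open>v\<close> everywhere and equal to \<open>v\<close> by
    \<open>nonprop\<close>.\<close>
  have top: "bounded_above n \<tau> (k - 1) H"
    unfolding bounded_above_def
  proof (intro ballI allI impI)
    fix v J assume v: "v \<in> H" "J \<subseteq> supp n v" "k - 1 < card J"
    have cv: "card (supp n v) = k" "finite (supp n v)" using H(2)[OF v(1)] by (auto simp: sparse_vector_def)
    have J: "J = supp n v" using cv v(2,3) by (intro card_seteq) auto
    have "{w \<in> H. prop_on J v w} \<subseteq> {v}"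
    proof
      fix w assume w: "w \<in> {w \<in> H. prop_on J v w}"
      then obtain c where c: "c \<in> nonzero_elems R" "\<And>i. i \<in> J \<Longrightarrow> w i = c \<otimes> v i"
        by (auto simp: prop_on_def)
      have cl: "v i \<in> carrier R" "w i \<in> carrier R" if "i < n" for i
        using H(2)[of v] H(2)[of w] v(1) w coord_closed[OF _ that] by (auto simp: sparse_vector_def)
      have "J \<subseteq> supp n w"
        using c J cl by (auto simp: nonzero_elems_def integral_iff)
      moreover have "card (supp n w) = k" using H(2) w by (auto simp: sparse_vector_def)
      ultimately have "J = supp n w" using J cv by (intro card_seteq) auto
      have "w i = c \<otimes> v i" if "i < n" for i
      proof (cases "i \<in> J")
        case False
        then have "w i = \<zero>" "v i = \<zero>"
          using \<open>J = supp n w\<close> J that by auto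
        then show ?thesis using c(1) by (simp add: nonzero_elems_def)
      qed (rule c(2))
      then have "prop_on {..<n} v w" using c(1) by (auto simp: prop_on_def)
      then show "w \<in> {v}" using nonprop v(1) w by blast
    qed
    then have "card {w \<in> H. prop_on J v w} \<le> card {v}"
      by (intro card_mono) auto
    then show "card {w \<in> H. prop_on J v w} \<le> \<tau> (card J)"
      using \<tau>[of "card J"] by simp
  qed
  have "\<exists>A\<subseteq>H. bounded_above n \<tau> (k - 1 - j) A \<and> real (card H) \<le> real (card A) + real j * \<theta>" if "j \<le> k - 1" for j
    using that
  proof (induction j)
    case 0
    then show ?case using top by auto
  next
    case (Suc j)
    then obtain A where A: "A \<subseteq> H" "bounded_above n \<tau> (k - 1 - j) A"
      "real (card H) \<le> real (card A) + real j * \<theta>" by auto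
    have "1 \<le> k - 1 - j" "k - 1 - j < k" using Suc.prems by auto
    from stage[OF A(1,2) this] obtain B where "B \<subseteq> A" "bounded_above n \<tau> (k - 1 - j - 1) B"
      "real (card A) \<le> real (card B) + \<theta>" by blast
    then show ?case using A by (intro exI[of _ B]) (auto simp: algebra_simps)
  qed
  from this[of "k - 1"] obtain A where A: "A \<subseteq> H" "bounded_above n \<tau> 0 A"
    "real (card H) \<le> real (card A) + real (k - 1) * \<theta>" by auto
  have finA: "finite A" using A(1) H(1) finite_subset by blast
  have "k * card A \<le> n * \<tau> 1"
    by (rule bounded_above_0_card[OF finA _ A(2)]) (use H(2) A(1) in auto)
  moreover have "card A \<le> k * card A" using k by simp
  ultimately have "real (card A) \<le> real (n * \<tau> 1)" by (metis of_nat_le_iff order_trans)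
  moreover have "real (k - 1) * \<theta> \<le> real k * \<theta>"
    using \<theta> by (intro mult_right_mono) auto
  ultimately show False using large A(3) by linarith
qed

end

section \<open>From packed groups to a Kikuchi graph\<close>

context field
begin

text \<open>Multiplying each \<open>v\<close> by a scalar \<open>\<nu> v\<close> makes the members
  of a group agree exactly with its centre on the base, so that their differences vanish there.
  Supports do not change, and the coefficients of the dependency absorb
  \<open>\<nu>\<close>.\<close>

lemma dependency_of_petals:
  assumes fin: "finite (carrier R)" and H: "finite H" "\<And>v. v \<in> H \<Longrightarrow> sparse_vector R n k v" and t: "t < k"
    and P: "pairwise disjnt \<P>" "\<And>G. G \<in> \<P> \<Longrightarrow> G \<subseteq> H \<and> card G = \<tau> t \<and> petals n t G"
      "bounded_above n \<tau> t (\<Union>\<P>)"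
    and s1: "s1 \<le> k - t" and \<tau>: "\<And>j. 0 < \<tau> j" and pos: "0 < n" "0 < l"
    and sparse: "\<And>i j. i \<le> s1 \<Longrightarrow> j \<le> k - t - s1 \<Longrightarrow> l ^ (k - t - (i + j)) * (\<tau> (t + i) * \<tau> (t + j))
      \<le> 9 * (n * card (nonzero_elems R)) ^ (k - t - (i + j))"
    and sparse0: "l ^ (k - t) * (card (nonzero_elems R) * \<tau> t) \<le> 9 * (n * card (nonzero_elems R)) ^ (k - t)"
    and large: "4 * (d + 3 * r * (4 * (2 ^ (k - t) * 54))) * (n * card (nonzero_elems R)) ^ (k - t)
      < card (nonzero_elems R) * card (\<Union>\<P>) * (\<tau> t - 1) * l ^ (k - t)"
    and d: "(n * card (nonzero_elems R)) ^ ((k - t) * l) * (r * (4 * (2 ^ (k - t) * 54))) ^ r < d ^ r"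
  shows "small_dependency R n H (4 * r)"
proof -
  define M where "M = \<Union>\<P>"
  have MH: "M \<subseteq> H" using P(2) by (auto simp: M_def)
  have finM: "finite M" using MH H(1) finite_subset by blast
  define grp where "grp = (\<lambda>v. THE G. G \<in> \<P> \<and> v \<in> G)"
  have grp_eq: "grp v = G" if "G \<in> \<P>" "v \<in> G" for G v
    unfolding grp_def
    by (rule the_equality) (use that P(1) in \<open>auto simp: pairwise_def disjnt_iff\<close>)
  have grp: "grp v \<in> \<P>" "v \<in> grp v" if "v \<in> M" for v
    using that grp_eq by (auto simp: M_def)
  have fibre: "{y \<in> M. grp y = grp x} = grp x" if x: "x \<in> M" for x
  proof
    show "{y \<in> M. grp y = grp x} \<subseteq> grp x" using grp(2) by force
    show "grp x \<subseteq> {y \<in> M. grp y = grp x}"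
      using grp(1)[OF x] grp_eq[OF grp(1)[OF x]] by (auto simp: M_def)
  qed
  have "\<forall>G\<in>\<P>. \<exists>J v. v \<in> coord_space R n \<and> J \<subseteq> supp n v \<and> card J = t \<and> (\<forall>w\<in>G. prop_on J v w)"
    using P(2) by (simp add: petals_def)
  then obtain base centre where "\<forall>G\<in>\<P>. centre G \<in> coord_space R n \<and>
      base G \<subseteq> supp n (centre G) \<and> card (base G) = t \<and> (\<forall>w\<in>G. prop_on (base G) (centre G) w)"
    unfolding bchoice_iff by blast
  then have bc: "\<And>G. G \<in> \<P> \<Longrightarrow> centre G \<in> coord_space R n \<and>
      base G \<subseteq> supp n (centre G) \<and> card (base G) = t \<and> (\<forall>w\<in>G. prop_on (base G) (centre G) w)"
    by (rule bspec)
  have cl: "v i \<in> carrier R" if "v \<in> M" "i < n" for v i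
    using H(2)[of v] MH that coord_closed by (auto simp: sparse_vector_def)
  have ex_scalar: "\<exists>c. c \<in> nonzero_elems R \<and> (\<forall>i\<in>base (grp v). c \<otimes> v i = centre (grp v) i)" if v: "v \<in> M" for v
  proof -
    obtain c where c: "c \<in> nonzero_elems R" "\<forall>i\<in>base (grp v). v i = c \<otimes> centre (grp v) i"
      using bc[OF grp(1)[OF v]] grp(2)[OF v] by (auto simp: prop_on_def)
    have u: "c \<in> Units R" using c(1) by (simp add: field_Units nonzero_elems_def)
    have "inv c \<in> Units R" using u by (rule Units_inv_Units)
    then have "inv c \<in> nonzero_elems R" by (simp add: field_Units nonzero_elems_def)
    moreover have "inv c \<otimes> v i = centre (grp v) i" if i: "i \<in> base (grp v)" for i
    proof -
      have "i < n" using bc[OF grp(1)[OF v]] i by auto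
      then have "centre (grp v) i \<in> carrier R" using bc[OF grp(1)[OF v]] coord_closed by blast
      then show ?thesis using c(2) i u by (simp add: m_assoc[symmetric] Units_closed)
    qed
    ultimately show ?thesis by blast
  qed
  define \<nu> where "\<nu> = (\<lambda>v. SOME c. c \<in> nonzero_elems R \<and> (\<forall>i\<in>base (grp v). c \<otimes> v i = centre (grp v) i))"
  have \<nu>: "\<nu> v \<in> nonzero_elems R" "\<And>i. i \<in> base (grp v) \<Longrightarrow> \<nu> v \<otimes> v i = centre (grp v) i"
    if "v \<in> M" for v
    using someI_ex[OF ex_scalar[OF that]] by (auto simp: \<nu>_def)
  have \<nu>': "\<nu> v \<in> carrier R" "\<nu> v \<noteq> \<zero>" if "v \<in> M" for v
    using \<nu>(1)[OF that] by (auto simp: nonzero_elems_def)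
  define f where "f = (\<lambda>v i. \<nu> v \<otimes> v i)"
  have f0: "f v i = \<zero> \<longleftrightarrow> v i = \<zero>" if "v \<in> M" "i < n" for v i
    using \<nu>'[OF that(1)] cl[OF that] by (simp add: f_def integral_iff)
  have base: "base (grp v) \<subseteq> supp n v" "card (base (grp v)) = t" if v: "v \<in> M" for v
  proof -
    note b = bc[OF grp(1)[OF v]]
    show "card (base (grp v)) = t" using b by blast
    show "base (grp v) \<subseteq> supp n v"
    proof
      fix i assume i: "i \<in> base (grp v)"
      then have "i < n" "centre (grp v) i \<noteq> \<zero>" using b by auto
      then show "i \<in> supp n v"
        using \<nu>(2)[OF v i] \<nu>'[OF v] by auto
    qed
  qed
  have ex_en: "\<exists>h. bij_betw h {..<k - t} {i. i < n \<and> i \<notin> base (grp v) \<and> f v i \<noteq> \<zero>}" if v: "v \<in> M" for v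
  proof -
    have "{i. i < n \<and> i \<notin> base (grp v) \<and> f v i \<noteq> \<zero>} = supp n v - base (grp v)"
      using f0[OF v] by auto
    moreover have "card (supp n v) = k" using H(2) MH v by (auto simp: sparse_vector_def)
    ultimately have "card {i. i < n \<and> i \<notin> base (grp v) \<and> f v i \<noteq> \<zero>} = k - t"
      using card_Diff_subset[OF finite_subset[OF base(1)[OF v]] base(1)[OF v]] base(2)[OF v] by simp
    then show ?thesis
      using ex_bij_betw_nat_finite[of "{i. i < n \<and> i \<notin> base (grp v) \<and> f v i \<noteq> \<zero>}"]
      by (simp add: atLeast0LessThan)
  qed
  define en where "en = (\<lambda>v. SOME h. bij_betw h {..<k - t} {i. i < n \<and> i \<notin> base (grp v) \<and> f v i \<noteq> \<zero>})"
  have en: "bij_betw (en v) {..<k - t} {i. i < n \<and> i \<notin> base (grp v) \<and> f v i \<noteq> \<zero>}" if "v \<in> M" for v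
    using someI_ex[OF ex_en[OF that]] by (simp add: en_def)
  interpret kikuchi_regular R n l "k - t" s1 M grp base f en t \<tau>
  proof
    show "finite (carrier R)" "finite M" by (fact fin finM)+
    show "f x i \<in> carrier R" if "x \<in> M" "i < n" for x i
      using \<nu>'[OF that(1)] cl[OF that] by (simp add: f_def)
    show "f x i = f y i" if "x \<in> M" "y \<in> M" "grp x = grp y" "i \<in> base (grp x)" for x y i
      using \<nu>(2)[of x i] \<nu>(2)[of y i] that by (simp add: f_def)
    show "bij_betw (en x) {..<k - t} {i. i < n \<and> i \<notin> base (grp x) \<and> f x i \<noteq> \<zero>}" if "x \<in> M" for x
      by (rule en[OF that])
    show "base (grp x) \<subseteq> {..<n} \<and> card (base (grp x)) = t" if "x \<in> M" for x
      using base[OF that] by auto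
    show "f x i \<noteq> \<zero>" if "x \<in> M" "i \<in> base (grp x)" for x i
      using base(1)[OF that(1)] f0[OF that(1)] that(2) by auto
    show card_fibre: "card {y \<in> M. grp y = grp x} = \<tau> t" if "x \<in> M" for x
      using fibre[OF that] P(2) grp[OF that] by simp
    \<comment> \<open>Equality of the rescaled vectors on \<open>J\<close> means proportionality of
      the original ones, so \<open>bounded_above\<close> applies once \<open>J\<close> exceeds the
      base; for \<open>J\<close> of size \<open>t\<close> the size of the group suffices.\<close>
    show "card {y \<in> M. grp y = grp x \<and> (\<forall>i\<in>J. f y i = f x i)} \<le> \<tau> (card J)"
      if x: "x \<in> M" and J: "base (grp x) \<subseteq> J" "J \<subseteq> {i. i < n \<and> f x i \<noteq> \<zero>}" for x J
    proof (cases "t < card J")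
      case True
      have Js: "J \<subseteq> supp n x" using J(2) f0[OF x] by auto
      have "{y \<in> M. grp y = grp x \<and> (\<forall>i\<in>J. f y i = f x i)} \<subseteq> {y \<in> M. prop_on J x y}"
      proof
        fix y assume "y \<in> {y \<in> M. grp y = grp x \<and> (\<forall>i\<in>J. f y i = f x i)}"
        then have y: "y \<in> M" and eq: "\<And>i. i \<in> J \<Longrightarrow> \<nu> y \<otimes> y i = \<nu> x \<otimes> x i" by (auto simp: f_def)
        have u: "\<nu> y \<in> Units R" using \<nu>'[OF y] by (simp add: field_Units)
        have "y i = (inv (\<nu> y) \<otimes> \<nu> x) \<otimes> x i" if "i \<in> J" for i
        proof -
          have i: "i < n" using that Js by auto
          have "y i = inv (\<nu> y) \<otimes> (\<nu> y \<otimes> y i)"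
            using u cl[OF y i] by (simp add: m_assoc[symmetric] Units_closed)
          then show ?thesis
            using eq[OF that] u cl[OF x i] \<nu>'[OF x] by (simp add: m_assoc Units_closed)
        qed
        moreover have "inv (\<nu> y) \<otimes> \<nu> x \<in> Units R"
          using u \<nu>'[OF x] by (intro Units_m_closed Units_inv_Units) (auto simp: field_Units)
        then have "inv (\<nu> y) \<otimes> \<nu> x \<in> nonzero_elems R"
          by (simp add: field_Units nonzero_elems_def)
        ultimately show "y \<in> {y \<in> M. prop_on J x y}"
          using y by (auto simp: prop_on_def)
      qed
      then have "card {y \<in> M. grp y = grp x \<and> (\<forall>i\<in>J. f y i = f x i)} \<le> card {y \<in> M. prop_on J x y}"
        using finM by (intro card_mono) auto
      also have "\<dots> \<le> \<tau> (card J)"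
        using P(3) x Js True unfolding bounded_above_def M_def by blast
      finally show ?thesis .
    next
      case False
      have "finite J" using J(2) finite_subset by fastforce
      then have "t \<le> card J"
        using card_mono[OF _ J(1)] base(2)[OF x] by simp
      then have "card J = t" using False by simp
      have "card {y \<in> M. grp y = grp x \<and> (\<forall>i\<in>J. f y i = f x i)} \<le> card {y \<in> M. grp y = grp x}"
        using finM by (intro card_mono) auto
      then show ?thesis using card_fibre[OF x] \<open>card J = t\<close> by simp
    qed
  qed (use s1 sparse sparse0 \<tau> in auto)
  obtain V \<beta> where V: "V \<noteq> {}" "V \<subseteq> M" "card V \<le> 4 * r" "\<beta> \<in> V \<rightarrow> nonzero_elems R"
    "\<And>i. i < n \<Longrightarrow> (\<Oplus>w\<in>V. \<beta> w \<otimes> f w i) = \<zero>"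
    using dependency[OF pos, of d r] large d unfolding M_def by blast
  show ?thesis
  proof (rule small_dependencyI[where \<alpha> = "\<lambda>v. \<beta> v \<otimes> \<nu> v"])
    show "V \<noteq> {}" "V \<subseteq> H" using V MH by auto
    show "real (card V) \<le> real (4 * r)" using V(3) by (rule of_nat_mono)
    show "\<beta> v \<otimes> \<nu> v \<in> nonzero_elems R" if "v \<in> V" for v
      using V(2,4) \<nu>' that by (auto simp: nonzero_elems_def Pi_iff integral_iff subset_iff)
    fix i assume i: "i < n"
    have "(\<Oplus>w\<in>V. \<beta> w \<otimes> \<nu> w \<otimes> w i) = (\<Oplus>w\<in>V. \<beta> w \<otimes> f w i)"
    proof (rule add.finprod_cong')
      fix w assume "w \<in> V"
      then have "w \<in> M" "\<beta> w \<in> carrier R" using V(2,4) by (auto simp: nonzero_elems_def)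
      then show "\<beta> w \<otimes> \<nu> w \<otimes> w i = \<beta> w \<otimes> f w i"
        using \<nu>' cl i by (simp add: f_def m_assoc)
    next
      show "(\<lambda>w. \<beta> w \<otimes> f w i) \<in> V \<rightarrow> carrier R"
        using V(2,4) \<nu>' cl i by (auto simp: nonzero_elems_def f_def Pi_iff subset_iff)
    qed simp
    then show "(\<Oplus>w\<in>V. \<beta> w \<otimes> \<nu> w \<otimes> w i) = \<zero>" using V(5)[OF i] by simp
  qed
qed

end

section \<open>Choice of parameters\<close>

text \<open>Beyond \<open>k / 2\<close> common coordinates a power of \<open>\<rho>\<close> with
  exponent \<open>k / 2 - j\<close> would drop below 1; cutting the exponent off at 0 makes these
  groups of bounded size.\<close>

definition gap :: "nat \<Rightarrow> nat \<Rightarrow> real" where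
  "gap k j = max 0 (real k / 2 - real j)"

text \<open>The sizes balance the number of pairs in a group against the chance that a state matches one of
  them; the summand 1 leaves at least two vectors in each group.\<close>

definition group_size :: "nat \<Rightarrow> real \<Rightarrow> nat \<Rightarrow> nat" where
  "group_size k \<rho> j = nat \<lceil>\<rho> powr gap k j\<rceil> + 1"

lemma gap_nonneg: "0 \<le> gap k j"
  by (simp add: gap_def)

lemma group_size_lower: "\<rho> powr gap k j \<le> real (group_size k \<rho> j - 1)"
  by (simp add: group_size_def real_nat_ceiling_ge)

lemma group_size_upper:
  assumes "1 \<le> \<rho>"
  shows "real (group_size k \<rho> j) \<le> 3 * \<rho> powr gap k j"
proof -
  have "1 \<le> \<rho> powr gap k j"
    using assms gap_nonneg by (rule ge_one_powr_ge_zero)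
  then show ?thesis
    unfolding group_size_def by linarith
qed

context
  fixes n l q :: nat and \<rho> :: real
  assumes l: "1 \<le> l" "l \<le> n" and q: "1 \<le> q"
    and \<rho>: "\<rho> = real (n * q) / real l"
begin

lemma ratio_ge_1: "1 \<le> \<rho>"
proof -
  have "l * 1 \<le> n * q" using l q by (intro mult_le_mono) auto
  then have "real l \<le> real (n * q)" by (simp only: mult_1_right of_nat_le_iff)
  then show ?thesis using l by (simp add: \<rho>)
qed

lemma ratio_power: "real l ^ a * \<rho> ^ a = real (n * q) ^ a"
  using l by (simp add: \<rho> power_divide)

text \<open>In exponents of \<open>\<rho>\<close> the claim is
  \<open>gap k (t + i) + gap k (t + j) \<le> k - t - i - j\<close>. If neither gap is cut off, the
  left side is \<open>k - 2 * t - i - j\<close>. If one is, its index, \<open>i\<close> or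
  \<open>j\<close>, has to be at most \<open>k / 2\<close>, which \<open>1 \<le> t\<close> ensures
  even for the half that is rounded up. If both are, \<open>i + j \<le> k - t\<close> is enough. The
  constant 9 comes from two factors 3 of \<open>group_size_upper\<close>.\<close>

lemma group_sizes_sparse:
  assumes t: "1 \<le> t" "t < k" and i: "i \<le> (k - t + 1) div 2" and j: "j \<le> k - t - (k - t + 1) div 2"
  shows "l ^ (k - t - (i + j)) * (group_size k \<rho> (t + i) * group_size k \<rho> (t + j)) \<le> 9 * (n * q) ^ (k - t - (i + j))"
proof -
  let ?a = "k - t - (i + j)"
  have ij: "2 * i \<le> k" "2 * j \<le> k" "i + j \<le> k - t" using i j t by auto
  then have r: "real i \<le> real k / 2" "real j \<le> real k / 2" "real ?a = real k - real t - real i - real j"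
    using t by auto
  have "0 \<le> real ?a" by simp
  then have "gap k (t + i) + gap k (t + j) \<le> real ?a"
    using r t by (auto simp: gap_def max_def)
  then have "\<rho> powr gap k (t + i) * \<rho> powr gap k (t + j) \<le> \<rho> ^ ?a"
    using ratio_ge_1 by (simp add: powr_add[symmetric] powr_mono flip: powr_realpow)
  moreover have "real (group_size k \<rho> (t + i)) * real (group_size k \<rho> (t + j))
      \<le> (3 * \<rho> powr gap k (t + i)) * (3 * \<rho> powr gap k (t + j))"
    by (intro mult_mono group_size_upper ratio_ge_1) auto
  ultimately have "real (group_size k \<rho> (t + i)) * real (group_size k \<rho> (t + j)) \<le> 9 * \<rho> ^ ?a"
    by linarith
  then have "real l ^ ?a * (real (group_size k \<rho> (t + i)) * real (group_size k \<rho> (t + j))) \<le> real l ^ ?a * (9 * \<rho> ^ ?a)"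
    by (intro mult_left_mono) auto
  also have "\<dots> = 9 * real (n * q) ^ ?a"
    using ratio_power[of ?a] by (simp only: mult.left_commute)
  finally have "real (l ^ ?a * (group_size k \<rho> (t + i) * group_size k \<rho> (t + j))) \<le> real (9 * (n * q) ^ ?a)"
    by simp
  then show ?thesis by (simp only: of_nat_le_iff)
qed

text \<open>Since \<open>l \<le> n\<close>, the free scalar costs \<open>q \<le> \<rho>\<close>, one
  more power of \<open>\<rho>\<close>, and \<open>1 + gap k t \<le> k - t\<close> leaves room for
  it.\<close>

lemma group_sizes_sparse_0:
  assumes t: "1 \<le> t" "t < k"
  shows "l ^ (k - t) * (q * group_size k \<rho> t) \<le> 9 * (n * q) ^ (k - t)"
proof -
  have "real q * real l \<le> real q * real n" using l by (intro mult_left_mono) auto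
  then have "real q \<le> \<rho>" using l by (simp add: \<rho> field_simps)
  moreover have "1 + gap k t \<le> real (k - t)"
    using t by (auto simp: gap_def max_def)
  then have "\<rho> * \<rho> powr gap k t \<le> \<rho> ^ (k - t)"
    using ratio_ge_1 powr_mono[of "1 + gap k t" "real (k - t)" \<rho>] by (simp add: powr_add powr_realpow)
  moreover have "real q * real (group_size k \<rho> t) \<le> \<rho> * (3 * \<rho> powr gap k t)"
    using \<open>real q \<le> \<rho>\<close> ratio_ge_1 by (intro mult_mono group_size_upper) auto
  moreover have "0 \<le> \<rho> ^ (k - t)" using ratio_ge_1 by simp
  ultimately have "real q * real (group_size k \<rho> t) \<le> 9 * \<rho> ^ (k - t)"
    by linarith
  then have "real l ^ (k - t) * (real q * real (group_size k \<rho> t)) \<le> real l ^ (k - t) * (9 * \<rho> ^ (k - t))"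
    by (intro mult_left_mono) auto
  also have "\<dots> = 9 * real (n * q) ^ (k - t)"
    using ratio_power[of "k - t"] by (simp only: mult.left_commute)
  finally have "real (l ^ (k - t) * (q * group_size k \<rho> t)) \<le> real (9 * (n * q) ^ (k - t))"
    by simp
  then show ?thesis by (simp only: of_nat_le_iff)
qed

text \<open>The cost \<open>\<rho> ^ (k - t)\<close> of matching \<open>k - t\<close> cells is at
  most \<open>\<rho> powr (k / 2) * \<rho> powr gap k t\<close>. The size of the groups makes up for
  the second factor, the number \<open>N\<close> of vectors for the first.\<close>

lemma average_degree_large:
  assumes t: "1 \<le> t" "t < k" and D: "4 * D < w * real l"
    and w: "w * (real l * \<rho> powr (real k / 2)) \<le> real q * real N" "0 \<le> w"
  shows "4 * D * real (n * q) ^ (k - t) < real q * real N * real (group_size k \<rho> t - 1) * real l ^ (k - t)"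
proof -
  have pos: "0 < \<rho>" "0 < real l" using ratio_ge_1 l by auto
  have "real (k - t) \<le> real k / 2 + gap k t"
    using t by (auto simp: gap_def max_def)
  then have "\<rho> ^ (k - t) \<le> \<rho> powr (real k / 2) * \<rho> powr gap k t"
    using ratio_ge_1 by (simp add: powr_add[symmetric] powr_mono flip: powr_realpow)
  have "4 * D * real (n * q) ^ (k - t) = (4 * D * \<rho> ^ (k - t)) * real l ^ (k - t)"
    by (simp only: ratio_power[symmetric] mult_ac)
  also have "\<dots> < (w * real l * \<rho> ^ (k - t)) * real l ^ (k - t)"
    using D pos by (intro mult_strict_right_mono) auto
  also have "\<dots> \<le> (w * real l * (\<rho> powr (real k / 2) * \<rho> powr gap k t)) * real l ^ (k - t)"
    using \<open>\<rho> ^ (k - t) \<le> _\<close> w(2) by (intro mult_right_mono mult_left_mono) auto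
  also have "\<dots> = (w * (real l * \<rho> powr (real k / 2))) * \<rho> powr gap k t * real l ^ (k - t)"
    by simp
  also have "\<dots> \<le> (real q * real N) * real (group_size k \<rho> t - 1) * real l ^ (k - t)"
    by (intro mult_right_mono mult_mono[OF w(1) group_size_lower]) auto
  finally show ?thesis .
qed

end

section \<open>Constants and the main estimate\<close>

definition expansion :: "nat \<Rightarrow> nat" where
  "expansion k = nat \<lceil>exp (8 * real k)\<rceil>"

text \<open>With the summand \<open>81 ^ 81\<close> there are not enough vectors at all unless \<open>n * |F*| \<ge> 81\<close>.\<close>

definition moore_constant :: "nat \<Rightarrow> real" where
  "moore_constant k = 2 * real k * (216 * 2 ^ k * (real (expansion k) + 3)) + 81 ^ 81"

lemma exp_le_expansion: "exp (8 * real k) \<le> real (expansion k)"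
  by (simp add: expansion_def real_nat_ceiling_ge)

lemma half_le_floor:
  assumes "1 \<le> (y :: real)"
  shows "y / 2 \<le> real (nat \<lfloor>y\<rfloor>)"
proof -
  have "1 \<le> \<lfloor>y\<rfloor>" using assms by simp
  moreover from this have "real (nat \<lfloor>y\<rfloor>) = of_int \<lfloor>y\<rfloor>" by simp
  moreover have "y < of_int \<lfloor>y\<rfloor> + 1" by simp
  ultimately show ?thesis by linarith
qed

text \<open>The threshold is \<open>3 ^ 4\<close>, as \<open>e \<le> 3\<close>. With
  \<open>ln m \<ge> 4\<close> the walks of length about \<open>l ln m / 4\<close> have at least one
  step.\<close>

lemma four_le_ln:
  assumes "81 \<le> m"
  shows "4 \<le> ln (real m)"
proof -
  have "exp (4 :: real) \<le> 3 ^ 4"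
    using power_mono[of "exp 1" "3 :: real" 4] exp_le by (simp flip: exp_of_nat_mult)
  also have "\<dots> \<le> real m" using assms by simp
  finally show ?thesis using assms by (subst ln_ge_iff) auto
qed

context field
begin

lemma moore_bound:
  assumes fin: "finite (carrier R)" and k: "2 \<le> k" and l: "1 \<le> l" "l \<le> n"
    and H: "finite H" "\<And>v. v \<in> H \<Longrightarrow> sparse_vector R n k v"
    and nonprop: "\<And>v w. v \<in> H \<Longrightarrow> w \<in> H \<Longrightarrow> prop_on {..<n} v w \<Longrightarrow> v = w"
    and m: "m = n * card (nonzero_elems R)" "81 \<le> m"
    and large: "moore_constant k * real n * (real m / real l) powr (real k / 2 - 1) * ln (real m) \<le> real (card H)"
  shows "small_dependency R n H (real l * ln (real m))"
proof -
  define q where "q = card (nonzero_elems R)"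
  define \<rho> where "\<rho> = real (n * q) / real l"
  \<comment> \<open>\<open>4 * r\<close> bounds the size of the dependency, so it has to stay below
    \<open>l ln m\<close>. As \<open>l ln m / 4 \<ge> 1\<close>, rounding down at most halves it,
    whence \<open>r \<ge> l ln m / 8\<close>.\<close>
  define r where "r = nat \<lfloor>real l * ln (real m) / 4\<rfloor>"
  \<comment> \<open>If each of the \<open>k - 1\<close> stages removed fewer than
    \<open>\<theta>\<close> vectors, at least half of \<open>H\<close> would survive, more than the
    degree bound for the last stage permits.\<close>
  define \<theta> where "\<theta> = real (card H) / (2 * real k)"
  let ?\<tau> = "group_size k \<rho>"
  have q: "1 \<le> q" using m by (cases q) (auto simp: q_def)
  have mnq: "real m = real (n * q)" by (simp add: m(1) q_def)
  have \<rho>1: "1 \<le> \<rho>" using ratio_ge_1[OF l q \<rho>_def] .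
  have ln_m: "4 \<le> ln (real m)" by (rule four_le_ln[OF m(2)])
  have llm: "4 \<le> real l * ln (real m)"
    using l ln_m mult_mono[of 1 "real l" 4 "ln (real m)"] by simp
  have r: "real l * ln (real m) / 8 \<le> real r" "4 * real r \<le> real l * ln (real m)"
    using half_le_floor[of "real l * ln (real m) / 4"] llm by (auto simp: r_def) linarith
  have r_pos: "0 < r" using r(1) llm by (cases r) auto
  have C_pos: "81 ^ 81 \<le> moore_constant k" "2 * real k * (216 * 2 ^ k * (real (expansion k) + 3)) + 1 \<le> moore_constant k"
    by (auto simp: moore_constant_def)
  define \<Lambda> where "\<Lambda> = \<rho> powr (real k / 2 - 1)"
  have \<Lambda>1: "1 \<le> \<Lambda>" unfolding \<Lambda>_def using \<rho>1 k by (intro ge_one_powr_ge_zero) auto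
  have large': "moore_constant k * real n * \<Lambda> * ln (real m) \<le> real (card H)"
    using large by (simp add: \<Lambda>_def \<rho>_def mnq)
  have nL: "0 < real n * \<Lambda>" using \<Lambda>1 l by auto
  have small_groups: "real k * \<theta> + real (n * ?\<tau> 1) < real (card H)"
  proof -
    have "gap k 1 = real k / 2 - 1" using k by (simp add: gap_def)
    then have "real (n * ?\<tau> 1) \<le> real n * (3 * \<Lambda>)"
      using group_size_upper[OF \<rho>1, of k 1] by (simp add: \<Lambda>_def mult_left_mono)
    moreover have "2 * (real n * (3 * \<Lambda>)) < real (card H)"
    proof -
      have "(6 :: real) < 81 ^ 81 * 4" by simp
      also have "\<dots> \<le> moore_constant k * ln (real m)"
        using C_pos(1) ln_m by (intro mult_mono) auto
      finally have "6 * (real n * \<Lambda>) < moore_constant k * ln (real m) * (real n * \<Lambda>)"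
        using nL by (rule mult_strict_right_mono)
      then show ?thesis using large' by (simp add: mult_ac)
    qed
    moreover have "real k * \<theta> = real (card H) / 2" using k by (simp add: \<theta>_def)
    ultimately show ?thesis by linarith
  qed
  have \<tau>: "0 < ?\<tau> j" for j by (simp add: group_size_def)
  have \<theta>: "0 \<le> \<theta>" by (simp add: \<theta>_def)
  have k1: "1 \<le> k" using k by simp
  obtain t \<P> where t: "1 \<le> t" "t < k" and P: "pairwise disjnt \<P>" "\<theta> \<le> real (card (\<Union>\<P>))"
    "\<And>G. G \<in> \<P> \<Longrightarrow> G \<subseteq> H \<and> card G = ?\<tau> t \<and> petals n t G" "bounded_above n ?\<tau> t (\<Union>\<P>)"
    by (rule petal_decomposition[where \<tau> = ?\<tau>, OF H k1 nonprop \<tau> small_groups \<theta>]) (assumption | rule that)+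
  let ?s = "k - t"
  let ?B = "4 * (2 ^ ?s * 54) :: nat"
  have B: "real ?B \<le> 216 * 2 ^ k"
  proof -
    have "(2 :: real) ^ ?s \<le> 2 ^ k" by (rule power_increasing) auto
    then show ?thesis by simp
  qed
  \<comment> \<open>A factor \<open>expansion k\<close> above \<open>r * B\<close>, the number of
    choices per step for walks with prescribed keys.\<close>
  define d where "d = r * ?B * expansion k"
  have deg: "4 * (d + 3 * r * ?B) * (n * q) ^ ?s < q * card (\<Union>\<P>) * (?\<tau> t - 1) * l ^ ?s"
  proof -
    \<comment> \<open>The summand \<open>1 / (2 * k)\<close> makes the comparison with
      \<open>4 * D\<close> strict; multiplied by \<open>2 * k\<close> it becomes the 1 that
      \<open>81 ^ 81\<close> in \<open>moore_constant\<close> absorbs.\<close>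
    let ?w = "(216 * 2 ^ k * (real (expansion k) + 3) + 1 / (2 * real k)) * ln (real m)"
    let ?D = "real r * real ?B * (real (expansion k) + 3)"
    have "4 * ?D < ?w * real l"
    proof -
      have "4 * ?D = (4 * real r) * (real ?B * (real (expansion k) + 3))" by simp
      also have "\<dots> \<le> (real l * ln (real m)) * (216 * 2 ^ k * (real (expansion k) + 3))"
        using llm by (intro mult_mono[OF r(2)] mult_right_mono[OF B]) auto
      also have "\<dots> < (real l * ln (real m)) * (216 * 2 ^ k * (real (expansion k) + 3) + 1 / (2 * real k))"
        using llm k by (intro mult_strict_left_mono) auto
      finally show ?thesis by (simp only: mult_ac)
    qed
    moreover have "?w * (real l * \<rho> powr (real k / 2)) \<le> real q * real (card (\<Union>\<P>))"
    proof -
      have "\<rho> powr (real k / 2) = \<rho> * \<Lambda>"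
        using \<rho>1 by (simp add: \<Lambda>_def powr_diff)
      then have eq: "real l * \<rho> powr (real k / 2) = real q * (real n * \<Lambda>)"
        using l by (simp add: \<rho>_def)
      have "2 * real k * ?w = (2 * real k * (216 * 2 ^ k * (real (expansion k) + 3)) + 1) * ln (real m)"
        using k by (simp add: field_simps)
      also have "\<dots> \<le> moore_constant k * ln (real m)"
        using C_pos(2) ln_m by (intro mult_right_mono) auto
      finally have "(2 * real k * ?w) * (real n * \<Lambda>) \<le> moore_constant k * ln (real m) * (real n * \<Lambda>)"
        using nL by (intro mult_right_mono) auto
      also have "\<dots> \<le> real (card H)" using large' by (simp add: mult_ac)
      finally have "(2 * real k) * (?w * (real n * \<Lambda>)) \<le> real (card H)" by (simp only: mult.assoc)
      then have "?w * (real n * \<Lambda>) \<le> \<theta>"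
        unfolding \<theta>_def using k by (subst pos_le_divide_eq) (auto simp: mult.commute)
      then have "real q * (?w * (real n * \<Lambda>)) \<le> real q * real (card (\<Union>\<P>))"
        using P(2) by (intro mult_left_mono) auto
      then show ?thesis by (simp only: eq mult.left_commute)
    qed
    moreover have "0 \<le> ?w" using ln_m by auto
    ultimately have D: "4 * ?D * real (n * q) ^ ?s < real q * real (card (\<Union>\<P>)) * real (?\<tau> t - 1) * real l ^ ?s"
      by (rule average_degree_large[OF l q \<rho>_def t])
    have "?D = real (d + 3 * r * ?B)"
      by (simp add: d_def algebra_simps)
    from D[unfolded this]
    have "real (4 * (d + 3 * r * ?B) * (n * q) ^ ?s) < real (q * card (\<Union>\<P>) * (?\<tau> t - 1) * l ^ ?s)"
      by (simp only: of_nat_mult of_nat_power of_nat_numeral)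
    then show ?thesis by (simp only: of_nat_less_iff)
  qed
  \<comment> \<open>The states number \<open>m ^ (s * l) = exp (s * l * ln m)\<close>, and
    \<open>expansion k ^ r\<close> is larger because \<open>s < k\<close>,
    \<open>r \<ge> l ln m / 8\<close> and \<open>expansion k \<ge> exp (8 * k)\<close>.\<close>
  have expand: "(n * q) ^ (?s * l) * (r * ?B) ^ r < d ^ r"
  proof -
    have "real m ^ (?s * l) = exp (real ?s * (real l * ln (real m)))"
    proof -
      have "real ?s * (real l * ln (real m)) = real (?s * l) * ln (real m)" by simp
      then show ?thesis using m(2) by (simp only: exp_of_nat_mult) simp
    qed
    also have "\<dots> < exp (8 * real k * (real l * ln (real m) / 8))"
    proof -
      have "real ?s * (real l * ln (real m)) < real k * (real l * ln (real m))"
        using llm t by (intro mult_strict_right_mono) auto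
      then show ?thesis by simp
    qed
    also have "\<dots> \<le> exp (8 * real k * real r)"
      unfolding exp_le_cancel_iff by (rule mult_left_mono[OF r(1)]) simp
    also have "\<dots> = exp (8 * real k) ^ r"
      by (simp add: mult.commute flip: exp_of_nat_mult)
    also have "\<dots> \<le> real (expansion k) ^ r"
      by (intro power_mono exp_le_expansion) auto
    finally have "(n * q) ^ (?s * l) < expansion k ^ r"
      by (metis mnq of_nat_less_iff of_nat_power)
    then have "(n * q) ^ (?s * l) * (r * ?B) ^ r < expansion k ^ r * (r * ?B) ^ r"
      using r_pos by (intro mult_strict_right_mono) auto
    then show ?thesis by (simp add: d_def power_mult_distrib mult_ac)
  qed
  have "small_dependency R n H (4 * r)"
  proof (rule dependency_of_petals[OF fin H t(2) P(1,3,4)])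
    \<comment> \<open>This instantiates \<open>s1\<close>: patterns are split into halves, the first
      rounded up.\<close>
    show "(k - t + 1) div 2 \<le> k - t" using t by auto
  qed (use l group_sizes_sparse[OF l q \<rho>_def t] group_sizes_sparse_0[OF l q \<rho>_def t] deg expand
      in \<open>simp_all add: q_def group_size_def\<close>)
  then show ?thesis
    by (rule small_dependency_mono) (use r(2) in auto)
qed

end

section \<open>Degenerate cases and conclusion\<close>

theorem theorem1p3:
  fixes k :: nat
  assumes "2 \<le> k"
  shows "\<exists>C::real. C > 0 \<and>
    (\<forall>(F :: 'a ring) (n :: nat) (l :: nat) (H :: (nat \<Rightarrow> 'a) set).
       field F \<longrightarrow> finite (carrier F) \<longrightarrow> 2 \<le> n \<longrightarrow>
       real k / 2 \<le> real l \<longrightarrow> l \<le> n * card (nonzero_elems F) \<longrightarrow>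
       (\<forall>v\<in>H. sparse_vector F n k v) \<longrightarrow>
       real (card H) \<ge> C * real n
          * (real n * real (card (nonzero_elems F)) / real l) powr (real k / 2 - 1)
          * ln (real (card (nonzero_elems F)) * real n) \<longrightarrow>
       (\<exists>V \<alpha>. V \<noteq> {} \<and> V \<subseteq> H \<and>
          real (card V) \<le> real l * ln (real (card (nonzero_elems F)) * real n) \<and>
          (\<forall>v\<in>V. \<alpha> v \<in> nonzero_elems F) \<and>
          lin_comb F n \<alpha> V = zero_vector F n))"
proof (intro exI[of _ "moore_constant k"] conjI allI impI)
  show "0 < moore_constant k"
    by (auto simp: moore_constant_def intro!: add_nonneg_pos)
  fix F :: "'a ring" and n l :: nat and H :: "(nat \<Rightarrow> 'a) set"
  define m where "m = n * card (nonzero_elems F)"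
  assume F: "field F" and fin: "finite (carrier F)" and n: "2 \<le> n" and "real k / 2 \<le> real l"
    and lm: "l \<le> n * card (nonzero_elems F)" and sp: "\<forall>v\<in>H. sparse_vector F n k v"
    and large0: "moore_constant k * real n
          * (real n * real (card (nonzero_elems F)) / real l) powr (real k / 2 - 1)
          * ln (real (card (nonzero_elems F)) * real n) \<le> real (card H)"
  interpret field F by fact
  have m_eq: "real (card (nonzero_elems F)) * real n = real m" "real n * real (card (nonzero_elems F)) = real m"
    by (simp_all add: m_def)
  have l: "1 \<le> l" using \<open>real k / 2 \<le> real l\<close> assms by (cases l) auto
  have "real l \<le> real m" using lm by (simp only: m_def of_nat_le_iff)
  then have m1: "1 \<le> real m / real l" using l by simp
  have n_le_m: "n \<le> m" using l lm by (cases "card (nonzero_elems F)") (auto simp: m_def)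
  have sub: "H \<subseteq> coord_space F n" using sp by (auto simp: sparse_vector_def)
  have finH: "finite H" by (rule finite_subset[OF sub finite_coord_space[OF fin]])
  note large = large0[unfolded m_eq]
  have C: "81 ^ 81 < moore_constant k"
    using assms by (auto simp: moore_constant_def intro!: mult_pos_pos add_nonneg_pos)
  have ln_m: "0 < ln (real m)" using n n_le_m by simp
  have lower: "moore_constant k * real n * ln (real m) \<le> real (card H)"
  proof -
    have "1 \<le> (real m / real l) powr (real k / 2 - 1)"
      using m1 assms by (intro ge_one_powr_ge_zero) auto
    then have "moore_constant k * real n * 1 * ln (real m)
        \<le> moore_constant k * real n * (real m / real l) powr (real k / 2 - 1) * ln (real m)"
      using C ln_m by (intro mult_right_mono mult_left_mono) auto
    then show ?thesis using large by simp
  qed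
  have m81: "81 \<le> m"
  proof (rule ccontr)
    assume small: "\<not> ?thesis"
    have c: "card (carrier F) = card (nonzero_elems F) + 1"
      using card_Suc_Diff1[OF fin zero_closed] by (simp add: nonzero_elems_def)
    have "1 * card (nonzero_elems F) \<le> m" using n unfolding m_def by (intro mult_le_mono) auto
    then have cF: "card (carrier F) \<le> 81" using small c by simp
    have "card H \<le> card (coord_space F n)"
      by (rule card_mono[OF finite_coord_space[OF fin] sub])
    also have "\<dots> = card (carrier F) ^ n" by (simp add: coord_space_def card_PiE)
    also have "\<dots> \<le> 81 ^ n" by (rule power_mono[OF cF]) simp
    also have "\<dots> \<le> 81 ^ 81" using small n_le_m by (intro power_increasing) auto
    finally have "real (card H) \<le> real (81 ^ 81)" by (rule of_nat_mono)
    \<comment> \<open>For \<open>m \<ge> 2\<close> the logarithm is at least \<open>1 / 2\<close>,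
      so the factor \<open>n ln m\<close> in the lower bound on \<open>card H\<close> does not undo
      the constant.\<close>
    moreover have "1 \<le> real n * ln (real m)"
    proof -
      have "ln (1 / real m) \<le> 1 / real m - 1" using n n_le_m by (intro ln_le_minus_one) auto
      moreover have "1 / real m \<le> 1 / 2" using n n_le_m by (intro divide_left_mono) auto
      moreover have "ln (1 / real m) = - ln (real m)" using n n_le_m by (simp add: ln_div)
      ultimately have "1 / 2 \<le> ln (real m)" by linarith
      then have "2 * (1 / 2) \<le> real n * ln (real m)" using n by (intro mult_mono) auto
      then show ?thesis by simp
    qed
    then have "moore_constant k * 1 \<le> moore_constant k * (real n * ln (real m))"
      using C by (intro mult_left_mono) auto
    ultimately show False using lower C by (simp add: mult.assoc)
  qed
  have ln4: "4 \<le> ln (real m)" by (rule four_le_ln[OF m81])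
  have llm: "real l * 4 \<le> real l * ln (real m)" using ln4 by (intro mult_left_mono) auto
  \<comment> \<open>Two distinct proportional vectors form a dependency by themselves; excluding
    them makes a vector determined up to scalars by its support entries, as the decomposition
    requires.\<close>
  have "small_dependency F n H (real l * ln (real m))"
  proof (cases "\<forall>v\<in>H. \<forall>w\<in>H. prop_on {..<n} v w \<longrightarrow> v = w")
    case False
    then obtain v w where vw: "v \<in> H" "w \<in> H" "v \<noteq> w" "prop_on {..<n} v w" by blast
    have "small_dependency F n {v, w} 2"
      by (rule proportional_dependent) (use vw sub in auto)
    then show ?thesis
    proof (rule small_dependency_mono)
      have "1 * 4 \<le> real l * ln (real m)" using ln4 l by (intro mult_mono) auto
      then show "2 \<le> real l * ln (real m)" by simp
    qed (use vw in auto)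
  next
    case nonprop: True
    show ?thesis
    proof (cases "l \<le> n")
      case True
      show ?thesis
        by (rule moore_bound[OF fin assms l True finH _ _ m_def m81 large]) (use sp nonprop in auto)
    next
      \<comment> \<open>For \<open>l > n\<close> the permitted size already admits
        \<open>n + 1\<close> vectors, which are dependent for reasons of dimension.\<close>
      case False
      have "(2 :: real) \<le> 81 ^ 81 * 4" by simp
      also have "\<dots> \<le> moore_constant k * ln (real m)" using C ln4 by (intro mult_mono) auto
      finally have "2 * real n \<le> moore_constant k * ln (real m) * real n" by (rule mult_right_mono) simp
      then have "real (2 * n) \<le> real (card H)" using lower by (simp add: mult_ac)
      then have "n + 1 \<le> card H" using n by simp
      then obtain W where W: "W \<subseteq> H" "card W = n + 1" "finite W"
        by (rule obtain_subset_with_card_n)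
      have "small_dependency F n W (card W)"
        by (rule many_vectors_dependent[OF fin _ W(3)]) (use W sub in auto)
      moreover have "real (card W) = real n + 1" "real n + 1 \<le> real l" using W(2) False by simp_all
      then have "real (card W) \<le> real l * ln (real m)" using llm by linarith
      ultimately show ?thesis
        by (rule small_dependency_mono[OF _ W(1)])
    qed
  qed
  then show "\<exists>V \<alpha>. V \<noteq> {} \<and> V \<subseteq> H \<and>
          real (card V) \<le> real l * ln (real (card (nonzero_elems F)) * real n) \<and>
          (\<forall>v\<in>V. \<alpha> v \<in> nonzero_elems F) \<and>
          lin_comb F n \<alpha> V = zero_vector F n"
    unfolding small_dependency_def m_eq .
qed

end
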